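(* Suppose $\phi:\mathbb R\to\mathbb R$ is a tanh-like nonlinearity in a reduced residual network (RRN), with mean-field quantities $p^{(l)},q^{(l)},\gamma^{(l)},\lambda^{(l)},e^{(l)},s^{(l)}$. Assume $e^{(0)}<1$. (1) If $\sigma_w=0$, then $\gamma^{(l)}=l\,\mathrm W\phi(\sigma_b^2,\sigma_b^2)+\gamma^{(0)}=l\,\mathrm V\phi(\sigma_b^2)+\gamma^{(0)}$ and $\lambda^{(l)}=\sigma_b^2$, so that $e^{(l)}\to1$ and $1-e^{(l)}=\Theta(l^{-1})$. As a result, $s^{(l)}=p^{(l)}(1-e^{(l)})=\Theta(1)$. (2) If $\sigma_w>0$, then $\gamma^{(l)}=\check\Theta(l^{2/\pi})$, and $e^{(l)}\to0$ like $\check\Theta(l^{\frac2\pi-1})$. Thus $s^{(l)}=\Theta(p^{(l)})=\Theta(l)$.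
   Context: A function $\phi$ is tanh-like if $\phi(-x)=-\phi(x)$, $|\phi(x)|\le 1$ for all $x$, $\phi(x)\ge 0$ for all $x\ge0$, and $\phi(x)$ monotonically increases to $1$ as $x\to\infty$. Put $\mathrm V\phi(q)=\mathbb E[\phi(z)^2]$ for $z\sim\mathcal N(0,q)$, and $\mathrm W\phi(\rho,\nu)=\mathbb E[\phi(z)\phi(z')]$ for $(z,z')\sim\mathcal N\!\left(0,\begin{pmatrix}\rho&\nu\\ \nu&\rho\end{pmatrix}\right)$. An RRN of width $N$ has layers $x^{(l)}_i=\phi(h^{(l)}_i)+x^{(l-1)}_i$, $h^{(l)}_i=\sum_j w^{(l)}_{ij}x^{(l-1)}_j+b^{(l)}_i$ with independent Gaussian parameters $w^{(l)}_{ij}\sim\mathcal N(0,\sigma_w^2/N)$, $b^{(l)}_i\sim\mathcal N(0,\sigma_b^2)$. Take two inputs $x^{(0)},x^{(0)\prime}$ with the same normalized squared length $p^{(0)}=\|x^{(0)}\|^2/N=\|x^{(0)\prime}\|^2/N$, and let $\gamma^{(0)}=x^{(0)}\cdot x^{(0)\prime}/N$. The mean-field ($N\to\infty$) quantities $p^{(l)}=\langle (x^{(l)}_1)^2\rangle$, $q^{(l)}=\langle (h^{(l)}_1)^2\rangle$, $\gamma^{(l)}=\langle x^{(l)}_1x^{(l)\prime}_1\rangle$, $\lambda^{(l)}=\langle h^{(l)}_1h^{(l)\prime}_1\rangle$ satisfy, for antisymmetric $\phi$ and $l\ge1$, $$q^{(l)}=\sigma_w^2p^{(l-1)}+\sigma_b^2,\quad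 p^{(l)}=\mathrm V\phi(q^{(l)})+p^{(l-1)},\quad \lambda^{(l)}=\sigma_w^2\gamma^{(l-1)}+\sigma_b^2,\quad \gamma^{(l)}=\mathrm W\phi(q^{(l)},\lambda^{(l)})+\gamma^{(l-1)}.$$ Further $e^{(l)}=\gamma^{(l)}/p^{(l)}$ and $s^{(l)}=p^{(l)}-\gamma^{(l)}=(1-e^{(l)})p^{(l)}$. Asymptotics are as $l\to\infty$. $f=\check\Theta(g)$ means that for every $\varepsilon>0$, $f(l)=O(g(l)l^{\varepsilon})$ and $f(l)=\Omega(g(l)l^{-\varepsilon})$. Asymptotic notations are sign-less (they may indicate positive or negative quantities).
   Formalization: Cases where the claims fail are excluded: in (1), e→1 and 1-e=Θ(1/l) need σ_b>0; in (2), e→0 and the Θ̌ claims need σ_b>0 or e^(0)≠-1, and the Θ̌ claims also need λ^(1)≠0. Inputs are nonzero so that e^(0) is defined. *)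

theory Defs
  imports "HOL-Probability.Probability" "HOL-Library.Landau_Symbols"
begin

definition tanh_like :: "(real \<Rightarrow> real) \<Rightarrow> bool" where
  "tanh_like \<phi> \<longleftrightarrow>
     (\<forall>x. \<phi> (- x) = - \<phi> x) \<and> (\<forall>x. \<bar>\<phi> x\<bar> \<le> 1) \<and> (\<forall>x\<ge>0. \<phi> x \<ge> 0) \<and>
     mono \<phi> \<and> (\<phi> \<longlongrightarrow> 1) at_top"

(* N(0,q) for a variance q \<ge> 0. The push-forward makes q = 0 the point mass at 0, which
   normal_density 0 0 (identically 0) would not. *)
definition gaussian :: "real \<Rightarrow> real measure" where
  "gaussian q = distr std_normal_distribution borel (\<lambda>u. sqrt q * u)"

lemma gaussian_eq_density:
  assumes "q > 0"
  shows "gaussian q = density lborel (normal_density 0 (sqrt q))"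
proof -
  interpret prob_space std_normal_distribution
    by (rule prob_space_normal_density) simp
  have "distributed std_normal_distribution lborel (\<lambda>u. u) (normal_density 0 1)"
    by (auto simp: distributed_def distr_id2)
  from normal_density_affine[OF this, of "sqrt q" 0] assms
  have "distr std_normal_distribution lborel (\<lambda>u. sqrt q * u) = density lborel (normal_density 0 (sqrt q))"
    by (simp add: distributed_def)
  moreover have "distr std_normal_distribution lborel (\<lambda>u. sqrt q * u) = gaussian q"
    unfolding gaussian_def by (rule distr_cong) auto
  ultimately show ?thesis by simp
qed

(* The centred normal law on the plane with covariance matrix ((\<rho>, \<nu>), (\<nu>, \<rho>)), where
   \<bar>\<nu>\<bar> \<le> \<rho>; singular covariances are included. With a = sqrt ((\<rho> + \<nu>) / 2) and
   b = sqrt ((\<rho> - \<nu>) / 2) it is the law of (a u + b v, a u - b v) for independent standard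
   normal u, v: both variances are a^2 + b^2 = \<rho> and the covariance is a^2 - b^2 = \<nu>. *)
definition gaussian_pair :: "real \<Rightarrow> real \<Rightarrow> (real \<times> real) measure" where
  "gaussian_pair \<rho> \<nu> =
     distr (std_normal_distribution \<Otimes>\<^sub>M std_normal_distribution) (borel \<Otimes>\<^sub>M borel)
       (\<lambda>(u, v). (sqrt ((\<rho> + \<nu>) / 2) * u + sqrt ((\<rho> - \<nu>) / 2) * v,
                  sqrt ((\<rho> + \<nu>) / 2) * u - sqrt ((\<rho> - \<nu>) / 2) * v))"

definition V :: "(real \<Rightarrow> real) \<Rightarrow> real \<Rightarrow> real" where
  "V \<phi> q = (\<integral>z. (\<phi> z)\<^sup>2 \<partial>gaussian q)"

definition W :: "(real \<Rightarrow> real) \<Rightarrow> real \<Rightarrow> real \<Rightarrow> real" where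
  "W \<phi> \<rho> \<nu> = (\<integral>(z, z'). \<phi> z * \<phi> z' \<partial>gaussian_pair \<rho> \<nu>)"

(* The mean-field quantities of a reduced residual network (antisymmetric \<phi>) on the inputs
   x, x', whose dimension CARD('n) is the width N used in the normalisation. Pre-activations
   exist from layer 1 on, so q 0 and lam 0 carry no meaning and are left unconstrained. *)
definition rrn_mean_field ::
  "(real \<Rightarrow> real) \<Rightarrow> real \<Rightarrow> real \<Rightarrow> real ^ 'n \<Rightarrow> real ^ 'n \<Rightarrow>
   (nat \<Rightarrow> real) \<Rightarrow> (nat \<Rightarrow> real) \<Rightarrow> (nat \<Rightarrow> real) \<Rightarrow> (nat \<Rightarrow> real) \<Rightarrow> bool" where
  "rrn_mean_field \<phi> \<sigma>w \<sigma>b x x' p q \<gamma> lam \<longleftrightarrow>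
     p 0 = (norm x)\<^sup>2 / real CARD('n) \<and> p 0 = (norm x')\<^sup>2 / real CARD('n) \<and>
     \<gamma> 0 = (x \<bullet> x') / real CARD('n) \<and>
     (\<forall>l\<ge>1. q l = \<sigma>w\<^sup>2 * p (l - 1) + \<sigma>b\<^sup>2 \<and>
            p l = V \<phi> (q l) + p (l - 1) \<and>
            lam l = \<sigma>w\<^sup>2 * \<gamma> (l - 1) + \<sigma>b\<^sup>2 \<and>
            \<gamma> l = W \<phi> (q l) (lam l) + \<gamma> (l - 1))"

(* Like bigo and bigomega, this compares absolute values, so signs are ignored. *)
definition Theta_check :: "(nat \<Rightarrow> real) \<Rightarrow> (nat \<Rightarrow> real) set" where
  "Theta_check g =
     {f. \<forall>\<epsilon>>0. f \<in> O(\<lambda>l. g l * real l powr \<epsilon>) \<and> f \<in> \<Omega>(\<lambda>l. g l * real l powr (- \<epsilon>))}"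

end

(*
The increments of gamma are odd in lam, so up to a sign lam may be taken to be nonnegative. Write
c = lam / q.

A reflection of the plane turns gaussian_pair into the law of sqrt q * (X, c X + tau Y) with
X, Y independent standard normal and tau = sqrt (1 - c^2), so W averages phi(sqrt q X) against
the Gaussian smoothing of phi evaluated at c X. For odd functions that are nonnegative on the
positive axis this smoothing is monotone in the function; comparing phi with the sign function
gives W <= (2 / pi) arcsin c for every q, while a first-order lower bound on the smoothing gives
W >= (2 / pi - o(1)) c as q tends to infinity and c tends to 0.

V - W is half the mean of (phi(z) - phi(z'))^2, and phi(z), phi(z') are at least 1 apart with
probability at least a constant times sqrt ((q - lam) / q). This square root beats the linear
term: by induction q - lam grows linearly, so c stays away from 1. On such a range
(2 / pi) arcsin c <= kappa c with kappa < 1, hence lam = O(l^kappa') for some kappa' < 1 and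
c tends to 0. Now W / c tends to 2 / pi, which fixes the exponent.
*)
theory Submission
  imports Defs
begin

subsection \<open>Integration against standard normal variables\<close>

text \<open>Since \<open>V\<close> tends to 1, \<open>q\<close> grows like
  \<open>\<sigma>w\<^sup>2 * l\<close>; a slope \<kappa> of \<open>W\<close> in c then multiplies
  \<open>lam\<close> by about 1 + \<kappa> / l per layer, which is the growth of l powr \<kappa>.
  Each estimate gives up an arbitrarily small part of the slope, and \<open>Theta_check\<close>
  forgives exactly that loss. The obstacle is circularity. The slope 2 / pi is available only near c
  = 0, while at c = 1 the bound (2 / pi) arcsin c equals 1 and cannot force c down. So the arcsin
  bound is used twice: first through a chord, which needs the linear gap and drives c to 0, then
  through the tangent at 0. The side conditions of the theorem exclude degenerate orbits. If both
  standard deviations vanish, p and gamma are constant. If \<open>\<sigma>w > 0\<close>,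
  \<open>\<sigma>b = 0\<close> and \<open>e 0 = -1\<close>, then lam = -q in every layer and e stays
  -1. If \<open>lam 1 = 0\<close>, oddness makes \<open>W\<close> vanish and gamma never
  moves.\<close>

abbreviation N :: "real measure" where "N \<equiv> std_normal_distribution"

interpretation N: prob_space N
  by (rule prob_space_normal_density) simp

interpretation NN: pair_prob_space N N ..

section \<open>Reflections of the standard normal plane\<close>

lemma std_pair_density:
  "N \<Otimes>\<^sub>M N = density (lborel \<Otimes>\<^sub>M lborel) (\<lambda>(x, y). ennreal (std_normal_density x * std_normal_density y))"
  by (subst pair_measure_density) (auto simp: ennreal_mult' lborel.sigma_finite_measure_axioms
       N.sigma_finite_measure_axioms)

text \<open>The map factors into two one-dimensional affine substitutions, one in y and, after
  Fubini, one in x. Their Jacobians 1 / |b| and |b| cancel.\<close>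

lemma nn_integral_reflect:
  fixes a b :: real and h :: "real \<times> real \<Rightarrow> ennreal"
  assumes ab: "a\<^sup>2 + b\<^sup>2 = 1" and b: "b \<noteq> 0" and [measurable]: "h \<in> borel_measurable borel"
  shows "(\<integral>\<^sup>+x. \<integral>\<^sup>+y. h (a * x + b * y, b * x - a * y) \<partial>lborel \<partial>lborel) = (\<integral>\<^sup>+x. \<integral>\<^sup>+y. h (x, y) \<partial>lborel \<partial>lborel)"
proof -
  have e1: "(\<integral>\<^sup>+y. h (a * x + b * y, b * x - a * y) \<partial>lborel)
      = ennreal \<bar>1 / b\<bar> * (\<integral>\<^sup>+w. h (w, b * x - a * ((w - a * x) / b)) \<partial>lborel)" for x
    using b by (subst nn_integral_real_affine[where c="1/b" and t="- a * x / b"])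
      (auto simp: field_simps intro!: arg_cong2[where f="(*)"] nn_integral_cong)
  \<comment> \<open>After x = a w + b t the second argument of \<open>h\<close> is t alone; this is
    where a^2 + b^2 = 1 enters.\<close>
  have k: "b * (a * w + b * t) - a * ((w - a * (a * w + b * t)) / b) = t" for w t
  proof -
    have "w - a * (a * w + b * t) = b * (b * w - a * t)"
      using ab by (simp add: algebra_simps power2_eq_square) (metis distrib_left mult.commute mult.left_commute mult_1)
    then have "(w - a * (a * w + b * t)) / b = b * w - a * t" using b by simp
    then have "b * (a * w + b * t) - a * ((w - a * (a * w + b * t)) / b) = (a\<^sup>2 + b\<^sup>2) * t"
      by (simp only:) (simp add: algebra_simps power2_eq_square)
    then show ?thesis using ab by simp
  qed
  have e2: "(\<integral>\<^sup>+x. h (w, b * x - a * ((w - a * x) / b)) \<partial>lborel) = ennreal \<bar>b\<bar> * (\<integral>\<^sup>+t. h (w, t) \<partial>lborel)" for w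
    using b by (subst nn_integral_real_affine[where c="b" and t="a * w"]) (auto simp: k simp del: times_divide_eq_right)
  have "(\<integral>\<^sup>+x. \<integral>\<^sup>+y. h (a * x + b * y, b * x - a * y) \<partial>lborel \<partial>lborel)
     = ennreal \<bar>1 / b\<bar> * (\<integral>\<^sup>+x. \<integral>\<^sup>+w. h (w, b * x - a * ((w - a * x) / b)) \<partial>lborel \<partial>lborel)"
    unfolding e1 by (rule nn_integral_cmult) measurable
  also have "(\<integral>\<^sup>+x. \<integral>\<^sup>+w. h (w, b * x - a * ((w - a * x) / b)) \<partial>lborel \<partial>lborel)
     = (\<integral>\<^sup>+w. \<integral>\<^sup>+x. h (w, b * x - a * ((w - a * x) / b)) \<partial>lborel \<partial>lborel)"
    by (rule lborel_pair.Fubini') measurable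
  also have "\<dots> = ennreal \<bar>b\<bar> * (\<integral>\<^sup>+x. \<integral>\<^sup>+y. h (x, y) \<partial>lborel \<partial>lborel)"
    unfolding e2 by (rule nn_integral_cmult) measurable
  finally show ?thesis using b
    by (simp add: mult.assoc[symmetric] ennreal_mult'[symmetric])
qed

text \<open>The product density depends only on x^2 + y^2, which the reflection preserves together
  with Lebesgue measure.\<close>

lemma distr_std_reflect:
  fixes a b :: real
  assumes ab: "a\<^sup>2 + b\<^sup>2 = 1" and b: "b \<noteq> 0"
  shows "distr (N \<Otimes>\<^sub>M N) (N \<Otimes>\<^sub>M N) (\<lambda>(x, y). (a * x + b * y, b * x - a * y)) = N \<Otimes>\<^sub>M N"
proof (rule measure_eqI)
  fix A assume "A \<in> sets (distr (N \<Otimes>\<^sub>M N) (N \<Otimes>\<^sub>M N) (\<lambda>(x, y). (a * x + b * y, b * x - a * y)))"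
  then have A: "A \<in> sets (N \<Otimes>\<^sub>M N)" by simp
  have s: "sets (N \<Otimes>\<^sub>M N) = sets (borel :: (real \<times> real) measure)"
    unfolding borel_prod[symmetric] by (rule sets_pair_measure_cong) simp_all
  have [measurable]: "A \<in> sets (borel :: (real \<times> real) measure)" using A s by simp
  have m: "(\<lambda>(x, y). (a * x + b * y, b * x - a * y)) \<in> measurable (N \<Otimes>\<^sub>M N) (N \<Otimes>\<^sub>M N)"
    by (subst measurable_cong_sets[OF s s]) (simp add: borel_prod[symmetric])
  define h where "h = (\<lambda>(x, y). ennreal (std_normal_density x * std_normal_density y) * indicator A (x, y))"
  have hm: "h \<in> borel_measurable borel" unfolding h_def borel_prod[symmetric] by measurable
  have em: "emeasure (N \<Otimes>\<^sub>M N) B = (\<integral>\<^sup>+x. \<integral>\<^sup>+y. ennreal (std_normal_density x * std_normal_density y) * indicator B (x, y) \<partial>lborel \<partial>lborel)"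
    if "B \<in> sets (N \<Otimes>\<^sub>M N)" for B
  proof -
    have [measurable]: "B \<in> sets (borel \<Otimes>\<^sub>M borel :: (real \<times> real) measure)" using that s by (simp add: borel_prod)
    show ?thesis unfolding std_pair_density
      by (subst emeasure_density) (auto simp: lborel.nn_integral_fst[symmetric] case_prod_beta)
  qed
  have d: "std_normal_density x * std_normal_density y
      = std_normal_density (a * x + b * y) * std_normal_density (b * x - a * y)" for x y
  proof -
    have "(a * x + b * y)\<^sup>2 + (b * x - a * y)\<^sup>2 = (a\<^sup>2 + b\<^sup>2) * (x\<^sup>2 + y\<^sup>2)" by algebra
    then have "x\<^sup>2 + y\<^sup>2 = (a * x + b * y)\<^sup>2 + (b * x - a * y)\<^sup>2" using ab by simp
    then show ?thesis
      by (simp add: std_normal_density_def exp_add[symmetric] add_divide_distrib[symmetric] )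
  qed
  show "emeasure (distr (N \<Otimes>\<^sub>M N) (N \<Otimes>\<^sub>M N) (\<lambda>(x, y). (a * x + b * y, b * x - a * y))) A = emeasure (N \<Otimes>\<^sub>M N) A"
    apply (subst emeasure_distr[OF m A])
    apply (subst em)
     apply (rule measurable_sets[OF m A])
    apply (subst em[OF A])
    using nn_integral_reflect[OF ab b hm]
    apply (simp add: h_def d[symmetric] space_pair_measure indicator_def case_prod_beta cong: if_cong)
    done
qed simp

lemma sets_std_pair: "sets (N \<Otimes>\<^sub>M N) = sets (borel :: (real \<times> real) measure)"
  unfolding borel_prod[symmetric] by (rule sets_pair_measure_cong) simp_all

lemma integral_std_reflect:
  fixes a b :: real and h :: "real \<Rightarrow> real \<Rightarrow> real"
  assumes "a\<^sup>2 + b\<^sup>2 = 1" "b \<noteq> 0"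
    and [measurable]: "case_prod h \<in> borel_measurable borel"
  shows "(\<integral>(x, y). h (a * x + b * y) (b * x - a * y) \<partial>(N \<Otimes>\<^sub>M N)) = (\<integral>(x, y). h x y \<partial>(N \<Otimes>\<^sub>M N))"
proof -
  have m: "(\<lambda>(x, y). (a * x + b * y, b * x - a * y)) \<in> measurable (N \<Otimes>\<^sub>M N) (N \<Otimes>\<^sub>M N)"
    by (subst measurable_cong_sets[OF sets_std_pair sets_std_pair]) (simp add: borel_prod[symmetric])
  have "case_prod h \<in> borel_measurable (N \<Otimes>\<^sub>M N)"
    by (subst measurable_cong_sets[OF sets_std_pair refl]) fact
  from integral_distr[OF m this] show ?thesis
    unfolding distr_std_reflect[OF assms(1,2)] by (simp add: case_prod_beta')
qed

lemma integrable_std_bounded: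
  fixes f :: "real \<Rightarrow> real"
  assumes "f \<in> borel_measurable borel" "\<And>x. \<bar>f x\<bar> \<le> B"
  shows "integrable N f"
  using assms by (intro N.integrable_const_bound[where B=B]) auto

lemma integrable_std_pair_bounded:
  fixes f :: "real \<times> real \<Rightarrow> real"
  assumes "f \<in> borel_measurable (N \<Otimes>\<^sub>M N)" "\<And>x. \<bar>f x\<bar> \<le> B"
  shows "integrable (N \<Otimes>\<^sub>M N) f"
  using assms by (intro NN.integrable_const_bound[where B=B]) auto

lemma integral_std_pair_fst:
  fixes f :: "real \<Rightarrow> real"
  assumes [measurable]: "f \<in> borel_measurable borel" and "\<And>x. \<bar>f x\<bar> \<le> B"
  shows "(\<integral>(x, y). f x \<partial>(N \<Otimes>\<^sub>M N)) = (\<integral>x. f x \<partial>N)"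
proof -
  have "integrable (N \<Otimes>\<^sub>M N) (\<lambda>(x, y). f x)"
    using assms(2) by (intro integrable_std_pair_bounded[where B=B]) (auto simp: case_prod_beta')
  from NN.integral_fst'[OF this] show ?thesis
    using N.prob_space by (simp add: case_prod_beta')
qed

section \<open>Gaussian smoothing of odd functions\<close>

lemma integral_std_uminus:
  fixes f :: "real \<Rightarrow> real"
  assumes [measurable]: "f \<in> borel_measurable borel"
  shows "(\<integral>x. f (- x) \<partial>N) = (\<integral>x. f x \<partial>N)"
  using lborel_integral_real_affine[of "-1" "\<lambda>x. std_normal_density x * f x" 0]
  by (simp add: integral_density std_normal_density_def)

lemma two_mult_le_exp_diff: "2 * t \<le> exp t - exp (- t)" if "t \<ge> 0" for t :: real
  using real_le_x_sinh[OF that] by (simp add: exp_minus)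

lemma integral_std_eq: "(\<integral>x. f x \<partial>N) = (\<integral>x. std_normal_density x * f x \<partial>lborel)"
  if "f \<in> borel_measurable borel" for f :: "real \<Rightarrow> real"
  using that by (simp add: integral_density)

lemma integrable_std_abs: "integrable N (\<lambda>x. \<bar>x\<bar>)"
  using integrable_std_normal_moment_abs[of 1] by (simp add: integrable_density)

lemma integral_std_abs: "(\<integral>x. \<bar>x\<bar> \<partial>N) = sqrt (2 / pi)"
  using integral_std_normal_moment_abs_odd[of 0] by (simp add: integral_density)

text \<open>Since \<open>g\<close> is odd, the right-hand side is half the integral of \<open>g x * (n (x - r) - n (x + r))\<close> for the
  normal density \<open>n\<close>, and \<open>n (x - r) - n (x + r) = 2 * exp (- r\<^sup>2 / 2) * sinh (r * x) * n x\<close>, where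
  \<open>sinh t \<ge> t\<close> for \<open>t \<ge> 0\<close>.\<close>
lemma integral_std_shift_ge:
  fixes g :: "real \<Rightarrow> real"
  assumes [measurable]: "g \<in> borel_measurable borel" and bound: "\<And>x. \<bar>g x\<bar> \<le> 1"
    and odd: "\<And>x. g (- x) = - g x" and nonneg: "\<And>x. x \<ge> 0 \<Longrightarrow> g x \<ge> 0" and r: "r \<ge> 0"
  shows "exp (- r\<^sup>2 / 2) * r * (\<integral>x. x * g x \<partial>N) \<le> (\<integral>x. g (r + x) \<partial>N)"
proof -
  let ?n = std_normal_density
  have int: "integrable lborel (\<lambda>x. ?n x * g (t + x))" for t
    using integrable_std_bounded[of "\<lambda>x. g (t + x)" 1] bound by (simp add: integrable_density)
  have i1: "integrable lborel (\<lambda>x. ?n (x - r) * g x)"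
    using lborel_integrable_real_affine[OF int[of r], of 1 "-r"] by simp
  have i2: "integrable lborel (\<lambda>x. ?n (x + r) * g x)"
    using lborel_integrable_real_affine[OF int[of "-r"], of 1 "r"] by (simp add: add.commute)
  have i3: "integrable lborel (\<lambda>x. ?n x * (x * g x))"
  proof -
    have "integrable N (\<lambda>x. x * g x)"
    proof (rule Bochner_Integration.integrable_bound[OF integrable_std_abs])
      show "AE x in N. norm (x * g x) \<le> norm \<bar>x\<bar>"
        using bound by (auto simp: abs_mult mult_left_le)
    qed simp
    then show ?thesis by (simp add: integrable_density)
  qed
  have e1: "(\<integral>x. g (r + x) \<partial>N) = (\<integral>x. ?n (x - r) * g x \<partial>lborel)"
    using lborel_integral_real_affine[of 1 "\<lambda>x. ?n x * g (r + x)" "-r"]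
    by (simp add: integral_std_eq)
  have e2: "(\<integral>x. ?n (x - r) * g x \<partial>lborel) = - (\<integral>x. ?n (x + r) * g x \<partial>lborel)"
  proof -
    have "?n (- x - r) = ?n (x + r)" for x
      by (simp add: std_normal_density_def power2_eq_square algebra_simps)
    then show ?thesis
      using lborel_integral_real_affine[of "-1" "\<lambda>x. ?n (x - r) * g x" 0] by (simp add: odd)
  qed
  have pw: "2 * (exp (- r\<^sup>2 / 2) * r) * (?n x * (x * g x)) \<le> ?n (x - r) * g x - ?n (x + r) * g x" for x
  proof -
    have n: "?n (x - r) = ?n x * (exp (- r\<^sup>2 / 2) * exp (r * x))"
      "?n (x + r) = ?n x * (exp (- r\<^sup>2 / 2) * exp (- (r * x)))"
      by (simp_all add: std_normal_density_def mult_exp_exp power2_eq_square algebra_simps add_divide_distrib diff_divide_distrib)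
    have "0 \<le> g x * (exp (r * x) - exp (- (r * x)) - 2 * (r * x))"
    proof (cases "x \<ge> 0")
      case True
      then show ?thesis using nonneg[OF True] two_mult_le_exp_diff[of "r * x"] r by simp
    next
      case False
      then have "g x \<le> 0" using nonneg[of "- x"] odd[of x] by simp
      moreover have "exp (r * x) - exp (- (r * x)) - 2 * (r * x) \<le> 0"
        using two_mult_le_exp_diff[of "- (r * x)"] r False by (simp add: mult_nonneg_nonpos)
      ultimately show ?thesis by (simp add: mult_nonpos_nonpos)
    qed
    then have "0 \<le> (?n x * exp (- r\<^sup>2 / 2)) * (g x * (exp (r * x) - exp (- (r * x)) - 2 * (r * x)))"
      by simp
    then show ?thesis unfolding n by (simp add: algebra_simps)
  qed
  have "2 * (exp (- r\<^sup>2 / 2) * r) * (\<integral>x. ?n x * (x * g x) \<partial>lborel)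
      \<le> (\<integral>x. ?n (x - r) * g x - ?n (x + r) * g x \<partial>lborel)"
    unfolding integral_mult_right_zero[symmetric]
    by (rule integral_mono) (use i1 i2 i3 pw in auto)
  also have "\<dots> = 2 * (\<integral>x. g (r + x) \<partial>N)"
    using i1 i2 e1 e2 by simp
  finally show ?thesis by (simp add: integral_std_eq)
qed

text \<open>Applied to a difference of two odd functions, this is the monotonicity of the smoothing:
  an order on the positive axis alone survives at every r \<ge> 0.\<close>

lemma integral_std_shift_nonneg:
  fixes g :: "real \<Rightarrow> real"
  assumes [measurable]: "g \<in> borel_measurable borel" and bound: "\<And>x. \<bar>g x\<bar> \<le> 1"
    and odd: "\<And>x. g (- x) = - g x" and nonneg: "\<And>x. x \<ge> 0 \<Longrightarrow> g x \<ge> 0" and r: "r \<ge> 0"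
  shows "0 \<le> (\<integral>x. g (r + x) \<partial>N)"
proof -
  have "0 \<le> (\<integral>x. x * g x \<partial>N)"
  proof (rule Bochner_Integration.integral_nonneg)
    fix x
    show "0 \<le> x * g x"
      using nonneg[of x] nonneg[of "-x"] odd[of x] by (cases "x \<ge> 0") (auto simp: mult_nonpos_nonpos)
  qed
  then have "0 \<le> exp (- r\<^sup>2 / 2) * r * (\<integral>x. x * g x \<partial>N)" using r by simp
  also have "\<dots> \<le> (\<integral>x. g (r + x) \<partial>N)" by (rule integral_std_shift_ge) (use assms in auto)
  finally show ?thesis .
qed

text \<open>On the positive axis \<open>sgn\<close> dominates every odd function bounded by 1, so
  its smoothing dominates too; and the smoothing of \<open>sgn\<close> at r is the probability that
  |x| is at most r.\<close>

lemma integral_std_shift_le: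
  fixes g :: "real \<Rightarrow> real"
  assumes [measurable]: "g \<in> borel_measurable borel" and bound: "\<And>x. \<bar>g x\<bar> \<le> 1"
    and odd: "\<And>x. g (- x) = - g x" and nonneg: "\<And>x. x \<ge> 0 \<Longrightarrow> g x \<ge> 0" and r: "r \<ge> 0"
  shows "(\<integral>x. g (r + x) \<partial>N) \<le> measure N {x. \<bar>x\<bar> \<le> r}"
proof -
  let ?s = "sgn :: real \<Rightarrow> real"
  have i: "integrable N (\<lambda>x. g (r + x))" "integrable N (\<lambda>x. ?s (r + x))" "integrable N (\<lambda>x. ?s (r - x))"
    by (rule integrable_std_bounded[where B=1]; use bound in \<open>auto simp: sgn_if\<close>)+
  have "0 \<le> (\<integral>x. ?s (r + x) - g (r + x) \<partial>N)"
  proof (rule integral_std_shift_nonneg[where g="\<lambda>x. ?s x - g x", OF _ _ _ _ r])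
    fix x
    have g0: "g 0 = 0" using odd[of 0] by simp
    show "\<bar>?s x - g x\<bar> \<le> 1"
      using bound[of x] nonneg[of x] nonneg[of "-x"] odd[of x] g0 by (auto simp: sgn_if)
    show "?s (- x) - g (- x) = - (?s x - g x)" by (simp add: odd)
    assume "0 \<le> x"
    then show "0 \<le> ?s x - g x" using bound[of x] g0 by (auto simp: sgn_if)
  qed simp
  then have "(\<integral>x. g (r + x) \<partial>N) \<le> (\<integral>x. ?s (r + x) \<partial>N)" using i by simp
  \<comment> \<open>Averaging over x and -x: the two signs cancel when |x| > r and are both 1 when
    |x| < r. On the boundary |x| = r the average is below 1, so only an inequality is
    claimed.\<close>
  also have "2 * \<dots> = (\<integral>x. ?s (r + x) \<partial>N) + (\<integral>x. ?s (r - x) \<partial>N)"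
    using integral_std_uminus[of "\<lambda>x. ?s (r + x)"] by simp
  then have "(\<integral>x. ?s (r + x) \<partial>N) = (\<integral>x. (?s (r + x) + ?s (r - x)) / 2 \<partial>N)"
    using i by simp
  also have "\<dots> \<le> (\<integral>x. indicator {x. \<bar>x\<bar> \<le> r} x \<partial>N)"
  proof (rule integral_mono)
    show "integrable N (\<lambda>x. (?s (r + x) + ?s (r - x)) / 2)" using i by simp
    show "integrable N (indicator {x. \<bar>x\<bar> \<le> r} :: real \<Rightarrow> real)"
      by (rule integrable_std_bounded[where B=1]) (auto simp: indicator_def)
    show "(?s (r + x) + ?s (r - x)) / 2 \<le> indicator {x. \<bar>x\<bar> \<le> r} x" for x
      by (auto simp: sgn_if indicator_def)
  qed
  also have "\<dots> = measure N {x. \<bar>x\<bar> \<le> r}" by simp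
  finally show ?thesis .
qed

text \<open>Substituting \<open>y = x * t\<close> and integrating over \<open>x\<close> first leaves the integral of
  \<open>1 / (pi * (1 + t\<^sup>2))\<close> over \<open>{-r..r}\<close>.\<close>
lemma integral_std_sector:
  assumes r: "r \<ge> 0"
  shows "(\<integral>x. measure N {y. \<bar>y\<bar> \<le> r * \<bar>x\<bar>} \<partial>N) = 2 / pi * arctan r"
proof -
  let ?n = std_normal_density
  have m: "(\<lambda>x. measure N {y. \<bar>y\<bar> \<le> r * \<bar>x\<bar>}) \<in> borel_measurable borel"
  proof -
    have "{p \<in> space (borel \<Otimes>\<^sub>M N). \<bar>snd p\<bar> \<le> r * \<bar>fst p\<bar>} \<in> sets (borel \<Otimes>\<^sub>M N)" by measurable
    from N.measurable_emeasure_Pair[OF this] show ?thesis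
      by (simp add: measure_def vimage_def space_pair_measure)
  qed
  \<comment> \<open>The two densities multiply to one normal density in s x with s^2 = 1 + t^2.
    Rescaling x leaves the first absolute moment sqrt (2 / pi) and a factor 1 / s^2.\<close>
  have mom: "(\<integral>\<^sup>+x. ennreal (?n x * (\<bar>x\<bar> * ?n (x * t))) \<partial>lborel) = ennreal (1 / pi / (1 + t\<^sup>2))" for t
  proof -
    define s where "s = sqrt (1 + t\<^sup>2)"
    have "1 + t\<^sup>2 > 0" by (simp add: add_pos_nonneg)
    then have s: "s > 0" "s\<^sup>2 = 1 + t\<^sup>2" unfolding s_def by simp_all
    have "?n x * ?n (x * t) = 1 / sqrt (2 * pi) * ?n (s * x)" for x
      by (simp add: std_normal_density_def mult_exp_exp power_mult_distrib s(2) algebra_simps add_divide_distrib diff_divide_distrib)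
    then have "(\<integral>\<^sup>+x. ennreal (?n x * (\<bar>x\<bar> * ?n (x * t))) \<partial>lborel)
        = (\<integral>\<^sup>+x. ennreal (1 / sqrt (2 * pi) * (\<bar>x\<bar> * ?n (s * x))) \<partial>lborel)"
      by (intro nn_integral_cong) (simp add: mult.left_commute)
    also have "\<dots> = ennreal (1 / s) * (\<integral>\<^sup>+u. ennreal (1 / sqrt (2 * pi) * (\<bar>u / s\<bar> * ?n u)) \<partial>lborel)"
      using s by (subst nn_integral_real_affine[where c="1/s" and t=0]) auto
    also have "(\<integral>\<^sup>+u. ennreal (1 / sqrt (2 * pi) * (\<bar>u / s\<bar> * ?n u)) \<partial>lborel) = (\<integral>\<^sup>+u. ennreal (1 / sqrt (2 * pi) / s * (?n u * \<bar>u\<bar> ^ (2 * 0 + 1))) \<partial>lborel)"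
      using s by (intro nn_integral_cong) (auto simp: field_simps)
    also have "\<dots> = ennreal (1 / sqrt (2 * pi) / s * sqrt (2 / pi))"
      using has_bochner_integral_mult_right[OF std_normal_moment_abs_odd[of 0], of "1 / sqrt (2 * pi) / s"] s
      by (subst nn_integral_eq_integral) (auto simp: has_bochner_integral_iff)
    also have "1 / sqrt (2 * pi) / s * sqrt (2 / pi) = 1 / pi / s"
      by (simp add: real_sqrt_mult real_sqrt_divide field_simps)
    also have "ennreal (1 / s) * ennreal (1 / pi / s) = ennreal (1 / pi / (1 + t\<^sup>2))"
      using s by (simp add: ennreal_mult'[symmetric] field_simps power2_eq_square)
    finally show ?thesis .
  qed
  have "(\<integral>\<^sup>+x. emeasure N {y. \<bar>y\<bar> \<le> r * \<bar>x\<bar>} \<partial>N)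
      = (\<integral>\<^sup>+x. ennreal (?n x) * (\<integral>\<^sup>+y. ennreal (?n y) * indicator {y. \<bar>y\<bar> \<le> r * \<bar>x\<bar>} y \<partial>lborel) \<partial>lborel)"
    by (simp add: nn_integral_density emeasure_density)
  also have "\<dots> = (\<integral>\<^sup>+x. \<integral>\<^sup>+t. ennreal (?n x * (\<bar>x\<bar> * ?n (x * t))) * indicator {-r..r} t \<partial>lborel \<partial>lborel)"
  \<comment> \<open>Only almost everywhere: the substitution y = x t fails at x = 0.\<close>
  proof (rule nn_integral_cong_AE)
    have "(\<integral>\<^sup>+y. ennreal (?n y) * indicator {y. \<bar>y\<bar> \<le> r * \<bar>x\<bar>} y \<partial>lborel)
        = ennreal \<bar>x\<bar> * (\<integral>\<^sup>+t. ennreal (?n (x * t)) * indicator {-r..r} t \<partial>lborel)" if "x \<noteq> 0" for x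
    proof -
      have "\<bar>x * t\<bar> \<le> r * \<bar>x\<bar> \<longleftrightarrow> t \<in> {-r..r}" for t
        using that by (auto simp: abs_mult mult.commute[of r])
      then show ?thesis using that
        by (subst nn_integral_real_affine[where c=x and t=0]) (auto simp: indicator_def)
    qed
    then have "ennreal (?n x) * (\<integral>\<^sup>+y. ennreal (?n y) * indicator {y. \<bar>y\<bar> \<le> r * \<bar>x\<bar>} y \<partial>lborel)
        = (\<integral>\<^sup>+t. ennreal (?n x * (\<bar>x\<bar> * ?n (x * t))) * indicator {-r..r} t \<partial>lborel)" if "x \<noteq> 0" for x
      using that by (simp add: nn_integral_cmult[symmetric] ennreal_mult' mult.assoc)
    moreover have "AE x in lborel. x \<noteq> (0::real)" by (rule AE_lborel_singleton)
    ultimately show "AE x in lborel. ennreal (?n x) * (\<integral>\<^sup>+y. ennreal (?n y) * indicator {y. \<bar>y\<bar> \<le> r * \<bar>x\<bar>} y \<partial>lborel)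
        = (\<integral>\<^sup>+t. ennreal (?n x * (\<bar>x\<bar> * ?n (x * t))) * indicator {-r..r} t \<partial>lborel)" by auto
  qed
  also have "\<dots> = (\<integral>\<^sup>+t. \<integral>\<^sup>+x. ennreal (?n x * (\<bar>x\<bar> * ?n (x * t))) * indicator {-r..r} t \<partial>lborel \<partial>lborel)"
    by (rule lborel_pair.Fubini') measurable
  also have "\<dots> = (\<integral>\<^sup>+t. ennreal (1 / pi / (1 + t\<^sup>2)) * indicator {-r..r} t \<partial>lborel)"
    by (simp add: nn_integral_multc mom)
  also have "\<dots> = ennreal (1 / pi * arctan r - 1 / pi * arctan (- r))"
  proof (rule nn_integral_FTC_Icc)
    fix x :: real
    show "((\<lambda>x. 1 / pi * arctan x) has_real_derivative 1 / pi / (1 + x\<^sup>2)) (at x)"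
      by (auto intro!: derivative_eq_intros simp: inverse_eq_divide)
    show "0 \<le> 1 / pi / (1 + x\<^sup>2)" by simp
  qed (use r in auto)
  also have "1 / pi * arctan r - 1 / pi * arctan (- r) = 2 / pi * arctan r" by (simp add: arctan_minus)
  finally have "(\<integral>\<^sup>+x. ennreal (measure N {y. \<bar>y\<bar> \<le> r * \<bar>x\<bar>}) \<partial>N) = ennreal (2 / pi * arctan r)"
    by (simp add: N.emeasure_eq_measure)
  then show ?thesis
    using m r by (subst integral_eq_nn_integral) auto
qed

lemma measure_std_interval_ge:
  assumes "a \<le> b" "\<bar>a\<bar> \<le> M" "\<bar>b\<bar> \<le> M"
  shows "measure N {a..b} \<ge> std_normal_density M * (b - a)"
proof -
  have "ennreal (std_normal_density M * (b - a)) = (\<integral>\<^sup>+x. ennreal (std_normal_density M) * indicator {a..b} x \<partial>lborel)"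
    using assms by (simp add: nn_integral_cmult_indicator ennreal_mult')
  also have "\<dots> \<le> (\<integral>\<^sup>+x. ennreal (std_normal_density x) * indicator {a..b} x \<partial>lborel)"
  proof (rule nn_integral_mono)
    fix x
    have "std_normal_density M \<le> std_normal_density x" if "x \<in> {a..b}"
    proof -
      have "\<bar>x\<bar> \<le> \<bar>M\<bar>" using that assms by auto
      then have "x\<^sup>2 \<le> M\<^sup>2" by (simp add: abs_le_square_iff)
      then show ?thesis by (simp add: std_normal_density_def divide_right_mono)
    qed
    then show "ennreal (std_normal_density M) * indicator {a..b} x \<le> ennreal (std_normal_density x) * indicator {a..b} x"
      by (auto simp: indicator_def ennreal_leI)
  qed
  also have "\<dots> = emeasure N {a..b}" by (simp add: emeasure_density)
  finally show ?thesis by (simp add: N.emeasure_eq_measure)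
qed

lemma AE_std_nonzero: "AE x in N. x \<noteq> 0"
  using AE_lborel_singleton[of "0::real"] by (auto simp: AE_density)

subsection \<open>Real analysis\<close>

text \<open>The derivative has the sign of \<open>t * cos t - sin t\<close>, which vanishes at 0 and
  has derivative \<open>- t * sin t\<close>.\<close>

lemma sin_over_id_strict_decreasing:
  fixes x y :: real
  assumes "0 < x" "x < y" "y \<le> pi / 2"
  shows "sin y / y < sin x / x"
proof (rule DERIV_neg_imp_decreasing_open[OF assms(2)])
  fix t assume t: "x < t" "t < y"
  have t0: "0 < t" "t < pi / 2" using t assms by auto
  have "t * cos t - sin t < 0 * cos 0 - sin (0::real)"
  proof (rule DERIV_neg_imp_decreasing_open[OF t0(1)])
    fix s assume s: "0 < s" "s < t"
    then have "sin s > 0" using t0 by (intro sin_gt_zero) auto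
    moreover have "((\<lambda>t. t * cos t - sin t) has_real_derivative - s * sin s) (at s)"
      by (auto intro!: derivative_eq_intros)
    ultimately show "\<exists>d. ((\<lambda>t. t * cos t - sin t) has_real_derivative d) (at s) \<and> d < 0"
      using s by (intro exI[of _ "- s * sin s"]) auto
  qed (auto intro!: continuous_intros)
  then have "(t * cos t - sin t) / t\<^sup>2 < 0" using t0 by (simp add: divide_neg_pos)
  moreover have "((\<lambda>t. sin t / t) has_real_derivative (cos t * t - sin t * 1) / (t * t)) (at t)"
    using t0 by (intro DERIV_divide DERIV_sin DERIV_ident) simp
  then have "((\<lambda>t. sin t / t) has_real_derivative (t * cos t - sin t) / t\<^sup>2) (at t)"
    by (simp add: power2_eq_square mult.commute)
  ultimately show "\<exists>d. ((\<lambda>t. sin t / t) has_real_derivative d) (at t) \<and> d < 0" by blast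
next
  show "continuous_on {x..y} (\<lambda>t. sin t / t)"
    using assms by (intro continuous_on_divide continuous_on_sin continuous_on_id) auto
qed

text \<open>The constant is the slope of the chord of (2 / pi) arcsin from 0 to 1 - \<delta>. The
  chord from 0 to 1 has slope exactly 1, so staying away from 1 is what makes \<kappa> < 1. With c =
  sin t, the comparison of chords is the monotonicity of sin t / t.\<close>

lemma arcsin_chord_bound:
  fixes \<delta> :: real
  assumes "0 < \<delta>" "\<delta> < 1"
  obtains \<kappa> where "0 < \<kappa>" "\<kappa> < 1" "\<And>c. 0 \<le> c \<Longrightarrow> c \<le> 1 - \<delta> \<Longrightarrow> 2 / pi * arcsin c \<le> \<kappa> * c"
proof -
  define y where "y = arcsin (1 - \<delta>)"
  have sy: "sin y = 1 - \<delta>" using assms unfolding y_def by (intro sin_arcsin) auto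
  have y: "0 < y" "y < pi / 2"
    using assms arcsin_less_arcsin[of 0 "1 - \<delta>"] arcsin_lt_bounded[of "1 - \<delta>"] by (auto simp: y_def)
  define \<kappa> where "\<kappa> = 2 / pi * (y / sin y)"
  show ?thesis
  proof (rule that)
    show "0 < \<kappa>" using y sy assms by (simp add: \<kappa>_def)
    have "2 / pi < sin y / y"
      using sin_over_id_strict_decreasing[of y "pi / 2"] y by simp
    then have "2 / pi * y < sin y" using y by (simp add: pos_less_divide_eq)
    then have "2 / pi * y / sin y < 1" using sy assms by (simp only: divide_less_eq_1_pos)
    then show "\<kappa> < 1" by (simp add: \<kappa>_def)
    fix c :: real assume c: "0 \<le> c" "c \<le> 1 - \<delta>"
    show "2 / pi * arcsin c \<le> \<kappa> * c"
    proof (cases "c = 0")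
      case False
      define t where "t = arcsin c"
      have t: "sin t = c" "0 < t" "t \<le> y"
        using c False assms arcsin_less_arcsin[of 0 c] arcsin_le_arcsin[of c "1 - \<delta>"]
        by (auto simp: t_def y_def)
      have "sin y / y \<le> sin t / t"
        using sin_over_id_strict_decreasing[of t y] t y by (cases "t = y") auto
      then have "sin y * t \<le> sin t * y" using t y by (simp add: frac_le_eq divide_le_eq pos_le_divide_eq pos_divide_le_eq mult.commute)
      moreover have "sin y > 0" using sy assms by simp
      ultimately have "t \<le> (y / sin y) * sin t" by (simp add: pos_le_divide_eq mult_ac)
      then have "2 / pi * t \<le> 2 / pi * ((y / sin y) * sin t)" by (intro mult_left_mono) auto
      then show ?thesis using t by (simp add: t_def \<kappa>_def)
    qed simp
  qed
qed

lemma arcsin_small_bound: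
  assumes "(c :: nat \<Rightarrow> real) \<longlonglongrightarrow> 0" "\<And>n. c n \<ge> 0" "\<kappa> > 1"
  shows "eventually (\<lambda>n. arcsin (c n) \<le> \<kappa> * c n) sequentially"
proof -
  have "(arcsin has_real_derivative 1) (at 0)" using DERIV_arcsin[of 0] by simp
  then have "((\<lambda>h. arcsin h / h) \<longlongrightarrow> 1) (at 0)" by (simp add: DERIV_def)
  from order_tendstoD(2)[OF this assms(3)]
  have "eventually (\<lambda>h. arcsin h / h < \<kappa>) (at 0)" .
  \<comment> \<open>The filter is widened to include 0 itself, because \<open>c n\<close> may
    vanish.\<close>
  then have "eventually (\<lambda>h. h \<ge> 0 \<longrightarrow> arcsin h \<le> \<kappa> * h) (nhds 0)"
    unfolding eventually_at_filter
  proof eventually_elim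
    case (elim h)
    show ?case
    proof (intro impI)
      assume "0 \<le> h"
      then show "arcsin h \<le> \<kappa> * h"
        using elim by (cases "h = 0") (auto simp: pos_divide_less_eq)
    qed
  qed
  from eventually_compose_filterlim[OF this assms(1)] show ?thesis
    using assms(2) by simp
qed

text \<open>Bernoulli's inequality for exponents in [0, 1], obtained as the weighted mean inequality
  for 1 + x and 1.\<close>

lemma one_plus_powr_le:
  fixes x \<kappa> :: real
  assumes "0 \<le> x" "0 \<le> \<kappa>" "\<kappa> \<le> 1"
  shows "(1 + x) powr \<kappa> \<le> 1 + \<kappa> * x"
proof -
  have "(1 + x) powr \<kappa> * 1 powr (1 - \<kappa>) \<le> \<kappa> * (1 + x) + (1 - \<kappa>) * 1"
    using assms by (intro Youngs_inequality_0) auto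
  then show ?thesis by (simp add: distrib_left)
qed

text \<open>The comparison sequence is (n - 1) powr \<kappa>: its ratio (n / (n - 1)) powr \<kappa>
  is at least exp (\<kappa> / n), hence at least 1 + \<kappa> / n. For n powr \<kappa> the ratio (1
  + 1 / n) powr \<kappa> falls short when 0 < \<kappa> < 1.\<close>

lemma growth_upper:
  fixes u :: "nat \<Rightarrow> real"
  assumes nonneg: "\<And>n. u n \<ge> 0" and k: "\<kappa> \<ge> 0"
    and step: "eventually (\<lambda>n. u (Suc n) \<le> u n * (1 + \<kappa> / real n)) sequentially"
  shows "u \<in> O(\<lambda>n. real n powr \<kappa>)"
proof -
  from step obtain m where m: "\<And>n. n \<ge> m \<Longrightarrow> u (Suc n) \<le> u n * (1 + \<kappa> / real n)"
    by (auto simp: eventually_sequentially)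
  \<comment> \<open>From 2 on, n - 1 is positive and its power is at least 1.\<close>
  define n0 where "n0 = max m 2"
  have le: "u n \<le> u n0 * real (n - 1) powr \<kappa>" if "n \<ge> n0" for n
    using that
  proof (induction n rule: dec_induct)
    case base
    have "1 \<le> real (n0 - 1) powr \<kappa>" using k by (intro ge_one_powr_ge_zero) (auto simp: n0_def)
    from mult_left_mono[OF this nonneg[of n0]] show ?case by simp
  next
    case (step n)
    have n: "n \<ge> 2" "n \<ge> m" using step by (auto simp: n0_def)
    then have r: "real (n - 1) = real n - 1" "real n - 1 > 0" by auto
    have "1 + \<kappa> / n \<le> (real n / (real n - 1)) powr \<kappa>"
    proof -
      have "ln (1 - 1 / real n) \<le> - (1 / real n)" using ln_add_one_self_le_self2[of "- (1 / real n)"] n by simp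
      then have "1 / real n \<le> - ln ((real n - 1) / real n)" using n by (simp add: diff_divide_distrib)
      also have "\<dots> = ln (real n / (real n - 1))" using r n by (simp add: ln_div)
      finally have "\<kappa> * (1 / real n) \<le> \<kappa> * ln (real n / (real n - 1))" using k by (intro mult_left_mono)
      then have "exp (\<kappa> / n) \<le> (real n / (real n - 1)) powr \<kappa>" using r n by (simp add: powr_def)
      then show ?thesis using exp_ge_add_one_self[of "\<kappa> / n"] by linarith
    qed
    then have "u n * (1 + \<kappa> / n) \<le> (u n0 * real (n - 1) powr \<kappa>) * (real n / (real n - 1)) powr \<kappa>"
      using step nonneg k by (intro mult_mono) auto
    also have "\<dots> = u n0 * real (Suc n - 1) powr \<kappa>"
      using r by (simp add: powr_divide)
    finally show ?case using m[OF n(2)] by linarith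
  qed
  show ?thesis
  proof (rule bigoI[where c="u n0"], rule eventually_sequentiallyI[of n0])
    fix n assume n: "n \<ge> n0"
    have "u n \<le> u n0 * real (n - 1) powr \<kappa>" by (rule le[OF n])
    also have "\<dots> \<le> u n0 * real n powr \<kappa>" using k nonneg by (intro mult_left_mono powr_mono2) auto
    finally show "norm (u n) \<le> u n0 * norm (real n powr \<kappa>)" using nonneg[of n] by simp
  qed
qed

text \<open>Here n powr \<kappa> itself serves for comparison: for \<kappa> \<le> 1 Bernoulli bounds
  its ratio by 1 + \<kappa> / n.\<close>

lemma growth_lower:
  fixes u :: "nat \<Rightarrow> real"
  assumes pos: "\<And>n. u n > 0" and k: "0 \<le> \<kappa>" "\<kappa> \<le> 1"
    and step: "eventually (\<lambda>n. u (Suc n) \<ge> u n * (1 + \<kappa> / real n)) sequentially"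
  shows "u \<in> \<Omega>(\<lambda>n. real n powr \<kappa>)"
proof -
  from step obtain m where m: "\<And>n. n \<ge> m \<Longrightarrow> u (Suc n) \<ge> u n * (1 + \<kappa> / real n)"
    by (auto simp: eventually_sequentially)
  define n0 where "n0 = max m 1"
  define a where "a = u n0 / real n0 powr \<kappa>"
  have a: "a > 0" using pos by (simp add: a_def n0_def)
  have ge: "a * real n powr \<kappa> \<le> u n" if "n \<ge> n0" for n
    using that
  proof (induction n rule: dec_induct)
    case base
    then show ?case by (simp add: a_def n0_def)
  next
    case (step n)
    have n: "n \<ge> 1" "n \<ge> m" using step by (auto simp: n0_def)
    have "real (Suc n) = real n * (1 + 1 / real n)" using n by (simp add: field_simps)
    then have "a * real (Suc n) powr \<kappa> = (a * real n powr \<kappa>) * (1 + 1 / real n) powr \<kappa>"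
      by (simp add: powr_mult)
    also have "\<dots> \<le> u n * (1 + \<kappa> * (1 / real n))"
      using step one_plus_powr_le[of "1 / real n" \<kappa>] k less_imp_le[OF pos] by (intro mult_mono) auto
    also have "\<dots> \<le> u (Suc n)" using m[OF n(2)] by simp
    finally show ?case .
  qed
  show ?thesis
  proof (rule landau_omega.bigI[OF a], rule eventually_sequentiallyI[of n0])
    fix n assume n: "n \<ge> n0"
    then show "norm (u n) \<ge> a * norm (real n powr \<kappa>)" using ge[OF n] less_imp_le[OF pos[of n]] by simp
  qed
qed

section \<open>Asymptotic classes\<close>

lemma eventually_real_ge: "eventually (\<lambda>n. real n \<ge> x) sequentially"
  using filterlim_real_sequentially by (simp add: filterlim_at_top)

lemma bigtheta_realI:
  fixes f :: "nat \<Rightarrow> real"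
  assumes a: "a > 0" and le: "\<And>n. n \<ge> 1 \<Longrightarrow> a * real n \<le> f n" "\<And>n. n \<ge> 1 \<Longrightarrow> f n \<le> b * real n"
  shows "f \<in> \<Theta>(\<lambda>n. real n)"
proof (rule bigthetaI)
  have pos: "f n \<ge> 0" if "n \<ge> 1" for n
    using order_trans[OF _ le(1)[OF that]] a by simp
  show "f \<in> O(\<lambda>n. real n)"
    using le(2) pos by (intro bigoI[of _ b] eventually_sequentiallyI[of 1]) auto
  show "f \<in> \<Omega>(\<lambda>n. real n)"
    using le(1) pos by (intro landau_omega.bigI[OF a] eventually_sequentiallyI[of 1]) auto
qed

text \<open>The floor \<open>b\<close> is there because lower bounds are available only for
  exponents in a bounded range: \<open>b\<close> is 0 for gamma and -1 for e.\<close>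

lemma Theta_checkI:
  assumes upper: "\<And>\<kappa>. \<kappa> > a \<Longrightarrow> f \<in> O(\<lambda>n. real n powr \<kappa>)"
    and lower: "\<And>\<kappa>. b < \<kappa> \<Longrightarrow> \<kappa> < a \<Longrightarrow> f \<in> \<Omega>(\<lambda>n. real n powr \<kappa>)" and "b < a"
  shows "f \<in> Theta_check (\<lambda>n. real n powr a)"
  unfolding Theta_check_def
proof (intro CollectI allI impI conjI)
  fix \<epsilon> :: real assume e: "\<epsilon> > 0"
  show "f \<in> O(\<lambda>l. real l powr a * real l powr \<epsilon>)"
    using upper[of "a + \<epsilon>"] e by (simp add: powr_add)
  \<comment> \<open>For large \<epsilon> the exponent a - \<epsilon> drops below the floor; the
    midpoint of a and b is then a stronger admissible exponent.\<close>
  define \<kappa> where "\<kappa> = max (a - \<epsilon>) ((a + b) / 2)"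
  have k: "b < \<kappa>" "\<kappa> < a" "a - \<epsilon> \<le> \<kappa>" using e \<open>b < a\<close> by (auto simp: \<kappa>_def less_max_iff_disj)
  have "(\<lambda>n. real n powr \<kappa>) \<in> \<Omega>(\<lambda>n. real n powr (a - \<epsilon>))"
    using k(3) by (intro landau_omega.bigI[of 1] eventually_sequentiallyI[of 1]) (auto intro: powr_mono)
  from landau_omega.big_trans[OF lower[OF k(1,2)] this]
  show "f \<in> \<Omega>(\<lambda>l. real l powr a * real l powr - \<epsilon>)"
    by (simp add: powr_add[symmetric])
qed

lemma const_smallo_powr: "(\<lambda>n. c) \<in> o(\<lambda>n. real n powr \<kappa>)" if "\<kappa> > 0" for c :: real
proof (rule smalloI_tendsto)
  show "(\<lambda>n. c / real n powr \<kappa>) \<longlonglongrightarrow> 0"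
    using tendsto_mult_right_zero[OF tendsto_neg_powr[OF _ filterlim_real_sequentially, of "- \<kappa>"], of c] that
    by (simp add: powr_minus_divide)
  show "eventually (\<lambda>n. real n powr \<kappa> \<noteq> 0) sequentially"
    by (rule eventually_sequentiallyI[of 1]) auto
qed

lemma sqrt_one_minus_square_pos: "0 < sqrt (1 - c\<^sup>2)" if "0 \<le> c" "c < 1" for c :: real
  using that by (simp add: power_less_one_iff abs_square_less_1)

subsection \<open>Bounds on V and W\<close>

locale tanh_nonlinearity =
  fixes \<phi> :: "real \<Rightarrow> real"
  assumes tanh: "tanh_like \<phi>"
begin

lemma tanh_minus: "\<phi> (- x) = - \<phi> x" and tanh_abs_le: "\<bar>\<phi> x\<bar> \<le> 1"
  and tanh_nonneg: "x \<ge> 0 \<Longrightarrow> \<phi> x \<ge> 0" and tanh_mono: "x \<le> y \<Longrightarrow> \<phi> x \<le> \<phi> y"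
  and tanh_limit: "(\<phi> \<longlongrightarrow> 1) at_top"
  using tanh by (auto simp: tanh_like_def mono_def)

lemma tanh_0: "\<phi> 0 = 0"
  using tanh_minus[of 0] by simp

lemma tanh_measurable [measurable]: "\<phi> \<in> borel_measurable borel"
  using tanh by (intro borel_measurable_mono) (auto simp: tanh_like_def)

lemma V_eq: "V \<phi> q = (\<integral>u. (\<phi> (sqrt q * u))\<^sup>2 \<partial>N)"
  unfolding V_def gaussian_def by (subst integral_distr) auto

lemma W_eq:
  "W \<phi> \<rho> \<nu> = (\<integral>(u, v). \<phi> (sqrt ((\<rho> + \<nu>) / 2) * u + sqrt ((\<rho> - \<nu>) / 2) * v)
      * \<phi> (sqrt ((\<rho> + \<nu>) / 2) * u - sqrt ((\<rho> - \<nu>) / 2) * v) \<partial>(N \<Otimes>\<^sub>M N))"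
  unfolding W_def gaussian_pair_def by (subst integral_distr) (auto simp: case_prod_beta')

text \<open>Negating \<nu> exchanges the two coefficients. Exchanging u and v as well restores them
  but turns the second component into its negative, and \<phi> is odd.\<close>

lemma W_minus: "W \<phi> \<rho> (- \<nu>) = - W \<phi> \<rho> \<nu>"
proof -
  define a where "a = sqrt ((\<rho> + \<nu>) / 2)"
  define b where "b = sqrt ((\<rho> - \<nu>) / 2)"
  have "W \<phi> \<rho> (- \<nu>) = (\<integral>(u, v). \<phi> (b * u + a * v) * \<phi> (b * u - a * v) \<partial>(N \<Otimes>\<^sub>M N))"
    by (simp add: W_eq a_def b_def)
  also have "\<dots> = (\<integral>(u, v). \<phi> (b * v + a * u) * \<phi> (b * v - a * u) \<partial>(N \<Otimes>\<^sub>M N))"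
    using NN.integral_product_swap[of "\<lambda>(u, v). \<phi> (b * u + a * v) * \<phi> (b * u - a * v)"]
    by (simp add: case_prod_beta')
  also have "\<dots> = (\<integral>p. - (case p of (u, v) \<Rightarrow> \<phi> (a * u + b * v) * \<phi> (a * u - b * v)) \<partial>(N \<Otimes>\<^sub>M N))"
  proof (rule Bochner_Integration.integral_cong[OF refl])
    fix p :: "real \<times> real"
    show "(case p of (u, v) \<Rightarrow> \<phi> (b * v + a * u) * \<phi> (b * v - a * u))
        = - (case p of (u, v) \<Rightarrow> \<phi> (a * u + b * v) * \<phi> (a * u - b * v))"
      using tanh_minus[of "a * fst p - b * snd p"] by (simp add: case_prod_beta add.commute)
  qed
  also have "\<dots> = - W \<phi> \<rho> \<nu>"
    by (simp add: W_eq a_def b_def)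
  finally show ?thesis .
qed

lemma W_diag: "W \<phi> \<rho> \<rho> = V \<phi> \<rho>"
  unfolding W_eq V_eq
  using integral_std_pair_fst[where f="\<lambda>u. (\<phi> (sqrt \<rho> * u))\<^sup>2" and B=1]
  by (simp add: power2_eq_square[symmetric] abs_square_le_1 tanh_abs_le)

lemma smoothed_odd:
  fixes k s :: real
  shows "(\<integral>y. \<phi> (k * (- s + y)) \<partial>N) = - (\<integral>y. \<phi> (k * (s + y)) \<partial>N)"
proof -
  have "(\<integral>y. \<phi> (k * (- s + y)) \<partial>N) = (\<integral>y. \<phi> (k * (- s + - y)) \<partial>N)"
    using integral_std_uminus[of "\<lambda>y. \<phi> (k * (- s + y))"] by simp
  also have "\<dots> = (\<integral>y. - \<phi> (k * (s + y)) \<partial>N)"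
  proof (rule Bochner_Integration.integral_cong[OF refl])
    fix y
    have "k * (- s + - y) = - (k * (s + y))" by (simp add: algebra_simps)
    then show "\<phi> (k * (- s + - y)) = - \<phi> (k * (s + y))" by (simp only: tanh_minus)
  qed
  finally show ?thesis by simp
qed

lemma smoothed_measurable:
  "(\<lambda>x. \<integral>y. \<phi> (k * (r * x + y)) \<partial>N) \<in> borel_measurable borel"
proof -
  have "(\<lambda>(x, y). \<phi> (k * (r * x + y))) \<in> borel_measurable (borel \<Otimes>\<^sub>M N)" by measurable
  then show ?thesis by (rule N.borel_measurable_lebesgue_integral)
qed

lemma smoothed_abs_le: "\<bar>\<integral>y. \<phi> (k * (r * x + y)) \<partial>N\<bar> \<le> 1"
proof -
  have "\<bar>\<integral>y. \<phi> (k * (r * x + y)) \<partial>N\<bar> \<le> (\<integral>y. \<bar>\<phi> (k * (r * x + y))\<bar> \<partial>N)"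
    using integral_abs_bound by blast
  also have "\<dots> \<le> (\<integral>y. 1 \<partial>N)"
    by (intro integral_mono integrable_std_bounded[where B=1]) (auto simp: tanh_abs_le)
  finally show ?thesis using N.prob_space by simp
qed

section \<open>Pairs with correlation in [0, 1)\<close>

context
  fixes \<rho> \<nu> :: real
  assumes rn: "0 \<le> \<nu>" "\<nu> < \<rho>"
begin

text \<open>If c = \<nu> / \<rho> is cos \<theta>, then a = cos (\<theta> / 2) and b = sin (\<theta>
  / 2); the third and fourth facts are the double-angle formulas for cos \<theta> and sin
  \<theta>.\<close>

lemma half_angle:
  defines "a \<equiv> sqrt ((1 + \<nu> / \<rho>) / 2)" and "b \<equiv> sqrt ((1 - \<nu> / \<rho>) / 2)"
  shows "a\<^sup>2 + b\<^sup>2 = 1" "b > 0" "a\<^sup>2 - b\<^sup>2 = \<nu> / \<rho>" "2 * a * b = sqrt (1 - (\<nu> / \<rho>)\<^sup>2)"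
    "sqrt ((\<rho> + \<nu>) / 2) = sqrt \<rho> * a" "sqrt ((\<rho> - \<nu>) / 2) = sqrt \<rho> * b"
proof -
  have r: "0 \<le> \<nu> / \<rho>" "\<nu> / \<rho> < 1" using rn by auto
  show "a\<^sup>2 + b\<^sup>2 = 1" "b > 0" "a\<^sup>2 - b\<^sup>2 = \<nu> / \<rho>"
    using r by (auto simp: a_def b_def field_simps)
  have dbl: "4 * ((1 + t) / 2 * ((1 - t) / 2)) = 1 - t\<^sup>2" for t :: real
    by (simp add: field_simps power2_eq_square)
  have "2 * a * b = sqrt (4 * ((1 + \<nu> / \<rho>) / 2 * ((1 - \<nu> / \<rho>) / 2)))"
    unfolding a_def b_def by (simp only: real_sqrt_mult) simp
  also have "4 * ((1 + \<nu> / \<rho>) / 2 * ((1 - \<nu> / \<rho>) / 2)) = 1 - (\<nu> / \<rho>)\<^sup>2"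
    using dbl[of "\<nu> / \<rho>"] .
  finally show "2 * a * b = sqrt (1 - (\<nu> / \<rho>)\<^sup>2)" .
  have "(\<rho> + \<nu>) / 2 = \<rho> * ((1 + \<nu> / \<rho>) / 2)" "(\<rho> - \<nu>) / 2 = \<rho> * ((1 - \<nu> / \<rho>) / 2)"
    using rn by (auto simp: field_simps)
  then show "sqrt ((\<rho> + \<nu>) / 2) = sqrt \<rho> * a" "sqrt ((\<rho> - \<nu>) / 2) = sqrt \<rho> * b"
    by (simp_all only: a_def b_def real_sqrt_mult)
qed

text \<open>The reflected coordinates X = a u + b v and Y = b u - a v are again independent standard
  normals. The first component is sqrt \<rho> * X, and the double-angle formulas rewrite a u - b v
  as cos \<theta> * X + sin \<theta> * Y.\<close>

lemma integral_gaussian_pair_conditional: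
  fixes g :: "real \<Rightarrow> real \<Rightarrow> real"
  assumes g [measurable]: "case_prod g \<in> borel_measurable borel"
  shows "(\<integral>(u, v). g (sqrt ((\<rho> + \<nu>) / 2) * u + sqrt ((\<rho> - \<nu>) / 2) * v)
             (sqrt ((\<rho> + \<nu>) / 2) * u - sqrt ((\<rho> - \<nu>) / 2) * v) \<partial>(N \<Otimes>\<^sub>M N))
    = (\<integral>(x, y). g (sqrt \<rho> * x) (sqrt \<rho> * (\<nu> / \<rho> * x + sqrt (1 - (\<nu> / \<rho>)\<^sup>2) * y)) \<partial>(N \<Otimes>\<^sub>M N))"
proof -
  define a where "a = sqrt ((1 + \<nu> / \<rho>) / 2)"
  define b where "b = sqrt ((1 - \<nu> / \<rho>) / 2)"
  note ab = half_angle[folded a_def b_def]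
  define h where "h = (\<lambda>x y. g (sqrt \<rho> * x) (sqrt \<rho> * (\<nu> / \<rho> * x + sqrt (1 - (\<nu> / \<rho>)\<^sup>2) * y)))"
  have "(\<lambda>p::real\<times>real. (sqrt \<rho> * fst p, sqrt \<rho> * (\<nu> / \<rho> * fst p + sqrt (1 - (\<nu> / \<rho>)\<^sup>2) * snd p))) \<in> borel \<rightarrow>\<^sub>M borel"
    by (simp add: borel_prod[symmetric])
  from measurable_compose[OF this g] have hm: "case_prod h \<in> borel_measurable borel"
    by (simp add: h_def case_prod_beta')
  have eq: "h (a * u + b * v) (b * u - a * v) = g (sqrt \<rho> * a * u + sqrt \<rho> * b * v) (sqrt \<rho> * a * u - sqrt \<rho> * b * v)" for u v
  proof -
    have "\<nu> / \<rho> * (a * u + b * v) + sqrt (1 - (\<nu> / \<rho>)\<^sup>2) * (b * u - a * v) = (a\<^sup>2 + b\<^sup>2) * (a * u - b * v)"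
      unfolding ab(4)[symmetric] unfolding ab(3)[symmetric] by algebra
    then have "\<nu> / \<rho> * (a * u + b * v) + sqrt (1 - (\<nu> / \<rho>)\<^sup>2) * (b * u - a * v) = a * u - b * v"
      using ab(1) by simp
    then show ?thesis unfolding h_def by (simp only:) (simp add: algebra_simps)
  qed
  show ?thesis
    using integral_std_reflect[OF ab(1) _ hm] ab(2) unfolding ab(5,6) eq by (simp add: h_def)
qed

lemma W_conditional:
  "W \<phi> \<rho> \<nu> = (\<integral>x. \<phi> (sqrt \<rho> * x) * (\<integral>y. \<phi> (sqrt \<rho> * (\<nu> / \<rho> * x + sqrt (1 - (\<nu> / \<rho>)\<^sup>2) * y)) \<partial>N) \<partial>N)"
proof -
  let ?h = "\<lambda>(x, y). \<phi> (sqrt \<rho> * x) * \<phi> (sqrt \<rho> * (\<nu> / \<rho> * x + sqrt (1 - (\<nu> / \<rho>)\<^sup>2) * y))"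
  have "case_prod (\<lambda>x y. \<phi> x * \<phi> y) \<in> borel_measurable borel"
    unfolding borel_prod[symmetric] by measurable
  from integral_gaussian_pair_conditional[OF this]
  have "W \<phi> \<rho> \<nu> = (\<integral>p. ?h p \<partial>(N \<Otimes>\<^sub>M N))" unfolding W_eq .
  also have "integrable (N \<Otimes>\<^sub>M N) ?h"
    by (rule integrable_std_pair_bounded[where B=1]) (auto simp: abs_mult intro!: mult_le_one tanh_abs_le)
  from NN.integral_fst'[OF this]
  have "(\<integral>p. ?h p \<partial>(N \<Otimes>\<^sub>M N)) = (\<integral>x. (\<integral>y. ?h (x, y) \<partial>N) \<partial>N)" by simp
  finally show ?thesis by simp
qed

text \<open>Expanding the square leaves two second moments and the cross term \<open>W\<close>. Both
  moments are \<open>V\<close>: the first by the conditional form, the second from the first by the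
  symmetry v to -v.\<close>

lemma V_minus_W:
  "V \<phi> \<rho> - W \<phi> \<rho> \<nu> = (\<integral>(u, v). (\<phi> (sqrt ((\<rho> + \<nu>) / 2) * u + sqrt ((\<rho> - \<nu>) / 2) * v)
      - \<phi> (sqrt ((\<rho> + \<nu>) / 2) * u - sqrt ((\<rho> - \<nu>) / 2) * v))\<^sup>2 / 2 \<partial>(N \<Otimes>\<^sub>M N))"
proof -
  define a where "a = sqrt ((\<rho> + \<nu>) / 2)"
  define b where "b = sqrt ((\<rho> - \<nu>) / 2)"
  define z where "z = (\<lambda>p. \<phi> (a * fst p + b * snd p))"
  define z' where "z' = (\<lambda>p. \<phi> (a * fst p - b * snd p))"
  have [measurable]: "z \<in> borel_measurable (N \<Otimes>\<^sub>M N)" "z' \<in> borel_measurable (N \<Otimes>\<^sub>M N)"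
    unfolding z_def z'_def by measurable
  have z1: "\<bar>z p\<bar> \<le> 1" "\<bar>z' p\<bar> \<le> 1" for p by (auto simp: z_def z'_def tanh_abs_le)
  have i: "integrable (N \<Otimes>\<^sub>M N) (\<lambda>p. (z p)\<^sup>2)" "integrable (N \<Otimes>\<^sub>M N) (\<lambda>p. (z' p)\<^sup>2)"
      "integrable (N \<Otimes>\<^sub>M N) (\<lambda>p. z p * z' p)"
    by (rule integrable_std_pair_bounded[where B=1];
        auto simp: abs_mult abs_square_le_1 z1 intro!: mult_le_one)+
  have Vz: "(\<integral>p. (z p)\<^sup>2 \<partial>(N \<Otimes>\<^sub>M N)) = V \<phi> \<rho>"
  proof -
    have "(\<lambda>p. (\<phi> (fst p))\<^sup>2) \<in> borel_measurable (borel \<Otimes>\<^sub>M borel :: (real \<times> real) measure)"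
      by measurable
    then have "case_prod (\<lambda>x y. (\<phi> x)\<^sup>2) \<in> borel_measurable (borel :: (real \<times> real) measure)"
      by (simp add: borel_prod case_prod_beta')
    from integral_gaussian_pair_conditional[OF this]
    have "(\<integral>p. (z p)\<^sup>2 \<partial>(N \<Otimes>\<^sub>M N)) = (\<integral>(x, y). (\<phi> (sqrt \<rho> * x))\<^sup>2 \<partial>(N \<Otimes>\<^sub>M N))"
      by (simp add: z_def a_def b_def case_prod_beta')
    also have "\<dots> = V \<phi> \<rho>" unfolding V_eq
      by (rule integral_std_pair_fst[where B=1]) (auto simp: abs_square_le_1 tanh_abs_le)
    finally show ?thesis .
  qed
  have Vz': "(\<integral>p. (z' p)\<^sup>2 \<partial>(N \<Otimes>\<^sub>M N)) = V \<phi> \<rho>"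
  proof -
    have "(\<integral>p. (z' p)\<^sup>2 \<partial>(N \<Otimes>\<^sub>M N)) = (\<integral>x. \<integral>y. (z' (x, y))\<^sup>2 \<partial>N \<partial>N)"
      using NN.integral_fst'[OF i(2)] by simp
    also have "\<dots> = (\<integral>x. \<integral>y. (z (x, y))\<^sup>2 \<partial>N \<partial>N)"
    proof (rule Bochner_Integration.integral_cong[OF refl])
      fix x
      show "(\<integral>y. (z' (x, y))\<^sup>2 \<partial>N) = (\<integral>y. (z (x, y))\<^sup>2 \<partial>N)"
        using integral_std_uminus[of "\<lambda>y. (z' (x, y))\<^sup>2"] by (simp add: z_def z'_def)
    qed
    also have "\<dots> = V \<phi> \<rho>" using NN.integral_fst'[OF i(1)] Vz by simp
    finally show ?thesis .
  qed
  have Wz: "W \<phi> \<rho> \<nu> = (\<integral>p. z p * z' p \<partial>(N \<Otimes>\<^sub>M N))"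
    by (simp add: W_eq z_def z'_def a_def b_def case_prod_beta')
  have "(\<integral>p. (z p - z' p)\<^sup>2 / 2 \<partial>(N \<Otimes>\<^sub>M N)) = (\<integral>p. (z p)\<^sup>2 / 2 + (z' p)\<^sup>2 / 2 - z p * z' p \<partial>(N \<Otimes>\<^sub>M N))"
    by (intro Bochner_Integration.integral_cong) (auto simp: power2_eq_square field_simps)
  also have "\<dots> = V \<phi> \<rho> - W \<phi> \<rho> \<nu>"
    using i by (simp add: Vz Vz' Wz)
  finally show ?thesis by (simp add: z_def z'_def a_def b_def case_prod_beta')
qed

text \<open>Factoring out \<tau> gives Y unit weight, so the inner integral is the smoothing of the
  odd function \<phi> (k * _), with k = sqrt \<rho> * \<tau>, at the shift (c / \<tau>) * x.\<close>

lemma W_eq_smoothed: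
  defines "c \<equiv> \<nu> / \<rho>" and "\<tau> \<equiv> sqrt (1 - (\<nu> / \<rho>)\<^sup>2)"
  shows "W \<phi> \<rho> \<nu> = (\<integral>x. \<phi> (sqrt \<rho> * x) * (\<integral>y. \<phi> (sqrt \<rho> * \<tau> * (c / \<tau> * x + y)) \<partial>N) \<partial>N)"
proof -
  have "\<tau> > 0" unfolding \<tau>_def using rn by (intro sqrt_one_minus_square_pos) auto
  then have "sqrt \<rho> * \<tau> * (c / \<tau> * x + y) = sqrt \<rho> * (c * x + \<tau> * y)" for x y
    by (simp add: field_simps)
  then show ?thesis
    unfolding W_conditional \<tau>_def[symmetric]
    unfolding c_def[symmetric] by (simp only:)
qed

text \<open>With \<phi> (sqrt \<rho> * x) bounded by 1 for x \<ge> 0, what remains is the mass of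
  the double sector |Y| \<le> r |X|: angle 4 arctan r out of 2 pi.\<close>

lemma W_le_arctan: "W \<phi> \<rho> \<nu> \<le> 2 / pi * arctan (\<nu> / \<rho> / sqrt (1 - (\<nu> / \<rho>)\<^sup>2))"
proof -
  define \<tau> where "\<tau> = sqrt (1 - (\<nu> / \<rho>)\<^sup>2)"
  define r where "r = \<nu> / \<rho> / \<tau>"
  define k where "k = sqrt \<rho> * \<tau>"
  have t: "\<tau> > 0" unfolding \<tau>_def using rn by (intro sqrt_one_minus_square_pos) auto
  then have r: "r \<ge> 0" and k: "k > 0" using rn by (auto simp: r_def k_def)
  have le: "(\<integral>y. \<phi> (k * (s + y)) \<partial>N) \<le> measure N {y. \<bar>y\<bar> \<le> s}"
    and ge: "0 \<le> (\<integral>y. \<phi> (k * (s + y)) \<partial>N)" if "s \<ge> 0" for s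
    using integral_std_shift_le[of "\<lambda>y. \<phi> (k * y)" s] integral_std_shift_nonneg[of "\<lambda>y. \<phi> (k * y)" s] that k
    by (auto simp: tanh_abs_le tanh_minus tanh_nonneg)
  \<comment> \<open>\<phi> and its smoothing are both odd, so their product is even and x \<ge> 0
    suffices.\<close>
  have pw: "\<phi> (sqrt \<rho> * x) * (\<integral>y. \<phi> (k * (r * x + y)) \<partial>N) \<le> measure N {y. \<bar>y\<bar> \<le> r * \<bar>x\<bar>}" for x
  proof -
    have pos: "\<phi> (sqrt \<rho> * x) * (\<integral>y. \<phi> (k * (r * x + y)) \<partial>N) \<le> measure N {y. \<bar>y\<bar> \<le> r * x}" if "x \<ge> 0" for x
    proof -
      have "\<phi> (sqrt \<rho> * x) * (\<integral>y. \<phi> (k * (r * x + y)) \<partial>N) \<le> 1 * (\<integral>y. \<phi> (k * (r * x + y)) \<partial>N)"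
        using ge[of "r * x"] r that tanh_abs_le[of "sqrt \<rho> * x"] by (intro mult_right_mono) auto
      also have "\<dots> \<le> measure N {y. \<bar>y\<bar> \<le> r * x}" using le[of "r * x"] r that by simp
      finally show ?thesis .
    qed
    show ?thesis
    proof (cases "x \<ge> 0")
      case True
      then show ?thesis using pos by simp
    next
      case False
      then show ?thesis
        using pos[of "- x"] smoothed_odd[of k "r * x"] tanh_minus[of "sqrt \<rho> * x"] by simp
    qed
  qed
  have "W \<phi> \<rho> \<nu> = (\<integral>x. \<phi> (sqrt \<rho> * x) * (\<integral>y. \<phi> (k * (r * x + y)) \<partial>N) \<partial>N)"
    unfolding W_eq_smoothed k_def r_def \<tau>_def ..
  also have "\<dots> \<le> (\<integral>x. measure N {y. \<bar>y\<bar> \<le> r * \<bar>x\<bar>} \<partial>N)"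
  proof (rule integral_mono[OF _ _ pw])
    show "integrable N (\<lambda>x. \<phi> (sqrt \<rho> * x) * (\<integral>y. \<phi> (k * (r * x + y)) \<partial>N))"
      using smoothed_measurable smoothed_abs_le tanh_abs_le
      by (intro integrable_std_bounded[where B=1]) (auto simp: abs_mult intro!: mult_le_one)
    have "{p \<in> space (borel \<Otimes>\<^sub>M N). \<bar>snd p\<bar> \<le> r * \<bar>fst p\<bar>} \<in> sets (borel \<Otimes>\<^sub>M N)" by measurable
    from N.measurable_emeasure_Pair[OF this]
    have "(\<lambda>x. measure N {y. \<bar>y\<bar> \<le> r * \<bar>x\<bar>}) \<in> borel_measurable borel"
      by (simp add: measure_def vimage_def space_pair_measure)
    then show "integrable N (\<lambda>x. measure N {y. \<bar>y\<bar> \<le> r * \<bar>x\<bar>})"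
      by (intro integrable_std_bounded[where B=1]) auto
  qed
  also have "\<dots> = 2 / pi * arctan r" by (rule integral_std_sector[OF r])
  finally show ?thesis unfolding r_def \<tau>_def .
qed

text \<open>The first-order bound \<open>integral_std_shift_ge\<close> is used at the shift r x and
  integrated against \<phi> (sqrt \<rho> * x). Its exponential factor is kept inside the x-integral,
  where it is harmless as r tends to 0.\<close>

lemma W_ge_mult:
  defines "\<tau> \<equiv> sqrt (1 - (\<nu> / \<rho>)\<^sup>2)"
  defines "r \<equiv> \<nu> / \<rho> / \<tau>"
  shows "W \<phi> \<rho> \<nu> \<ge> r * (\<integral>y. y * \<phi> (sqrt \<rho> * \<tau> * y) \<partial>N)
      * (\<integral>x. exp (- (r * x)\<^sup>2 / 2) * (x * \<phi> (sqrt \<rho> * x)) \<partial>N)"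
proof -
  define k where "k = sqrt \<rho> * \<tau>"
  define A where "A = (\<integral>y. y * \<phi> (k * y) \<partial>N)"
  have t: "\<tau> > 0" unfolding \<tau>_def using rn by (intro sqrt_one_minus_square_pos) auto
  then have r: "r \<ge> 0" and k: "k > 0" using rn by (auto simp: r_def k_def)
  have ge: "exp (- s\<^sup>2 / 2) * s * A \<le> (\<integral>y. \<phi> (k * (s + y)) \<partial>N)" if "s \<ge> 0" for s
    using integral_std_shift_ge[of "\<lambda>y. \<phi> (k * y)" s] that k
    by (auto simp: A_def tanh_abs_le tanh_minus tanh_nonneg)
  have pw: "(r * A) * (exp (- (r * x)\<^sup>2 / 2) * (x * \<phi> (sqrt \<rho> * x))) \<le> \<phi> (sqrt \<rho> * x) * (\<integral>y. \<phi> (k * (r * x + y)) \<partial>N)" for x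
  proof -
    have pos: "(r * A) * (exp (- (r * x)\<^sup>2 / 2) * (x * \<phi> (sqrt \<rho> * x))) \<le> \<phi> (sqrt \<rho> * x) * (\<integral>y. \<phi> (k * (r * x + y)) \<partial>N)" if "x \<ge> 0" for x
    proof -
      have "0 \<le> \<phi> (sqrt \<rho> * x)" using that rn by (intro tanh_nonneg) auto
      from mult_left_mono[OF ge[of "r * x"] this] show ?thesis using r that by (simp add: algebra_simps)
    qed
    show ?thesis
    proof (cases "x \<ge> 0")
      case True
      then show ?thesis using pos by simp
    next
      case False
      then show ?thesis
        using pos[of "- x"] smoothed_odd[of k "r * x"] tanh_minus[of "sqrt \<rho> * x"] by simp
    qed
  qed
  have "(\<integral>x. (r * A) * (exp (- (r * x)\<^sup>2 / 2) * (x * \<phi> (sqrt \<rho> * x))) \<partial>N)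
      \<le> (\<integral>x. \<phi> (sqrt \<rho> * x) * (\<integral>y. \<phi> (k * (r * x + y)) \<partial>N) \<partial>N)"
  proof (rule integral_mono[OF _ _ pw])
    show "integrable N (\<lambda>x. \<phi> (sqrt \<rho> * x) * (\<integral>y. \<phi> (k * (r * x + y)) \<partial>N))"
      using smoothed_measurable smoothed_abs_le tanh_abs_le
      by (intro integrable_std_bounded[where B=1]) (auto simp: abs_mult intro!: mult_le_one)
    have "integrable N (\<lambda>x. exp (- (r * x)\<^sup>2 / 2) * (x * \<phi> (sqrt \<rho> * x)))"
    proof (rule Bochner_Integration.integrable_bound[OF integrable_std_abs])
      have "\<bar>exp (- (r * x)\<^sup>2 / 2) * (x * \<phi> (sqrt \<rho> * x))\<bar> \<le> 1 * (\<bar>x\<bar> * 1)" for x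
        unfolding abs_mult by (intro mult_mono) (auto simp: tanh_abs_le)
      then show "AE x in N. norm (exp (- (r * x)\<^sup>2 / 2) * (x * \<phi> (sqrt \<rho> * x))) \<le> norm \<bar>x\<bar>" by simp
    qed simp
    then show "integrable N (\<lambda>x. (r * A) * (exp (- (r * x)\<^sup>2 / 2) * (x * \<phi> (sqrt \<rho> * x))))" by simp
  qed
  also have "\<dots> = W \<phi> \<rho> \<nu>"
    unfolding W_eq_smoothed k_def r_def \<tau>_def ..
  finally show ?thesis by (simp add: A_def k_def)
qed

text \<open>The right-hand side is the mean of sgn z * sgn z' for a Gaussian pair of correlation
  \<nu> / \<rho>, so the bound is the value for the limiting nonlinearity.\<close>

lemma W_le_arcsin: "W \<phi> \<rho> \<nu> \<le> 2 / pi * arcsin (\<nu> / \<rho>)"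
proof -
  have "0 \<le> \<nu> / \<rho>" "\<nu> / \<rho> < 1" using rn by auto
  then have "- 1 < \<nu> / \<rho>" by linarith
  then have "arcsin (\<nu> / \<rho>) = arctan (\<nu> / \<rho> / sqrt (1 - (\<nu> / \<rho>)\<^sup>2))"
    using \<open>\<nu> / \<rho> < 1\<close> by (rule arcsin_arctan)
  then show ?thesis using W_le_arctan by (simp only:)
qed

end

section \<open>Bounds uniform in the variance\<close>

lemma tanh_threshold: obtains K where "K > 0" "\<And>x. x \<ge> K \<Longrightarrow> \<phi> x \<ge> 1 / 2"
proof -
  have "eventually (\<lambda>x. \<phi> x > 1 / 2) at_top"
    using tanh_limit by (rule order_tendstoD) simp
  then obtain K where "\<And>x. x \<ge> K \<Longrightarrow> \<phi> x > 1 / 2" by (auto simp: eventually_at_top_linorder)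
  then have "\<phi> x \<ge> 1 / 2" if "x \<ge> max K 1" for x using that by (simp add: less_imp_le)
  then show ?thesis by (intro that[of "max K 1"]) auto
qed

lemma V_integrable: "integrable N (\<lambda>u. (\<phi> (sqrt q * u))\<^sup>2)"
  by (rule integrable_std_bounded[where B=1]) (auto simp: abs_square_le_1 tanh_abs_le)

lemma V_le_1: "V \<phi> q \<le> 1"
proof -
  have "V \<phi> q \<le> (\<integral>u. 1 \<partial>N)" unfolding V_eq
    by (intro integral_mono V_integrable) (auto simp: abs_square_le_1 tanh_abs_le)
  then show ?thesis using N.prob_space by simp
qed

lemma V_nonneg: "0 \<le> V \<phi> q"
  unfolding V_eq by simp

text \<open>One window of u serves all variances: for u \<ge> K / sqrt \<open>q\<^sub>0\<close> the
  argument sqrt q * u has passed the threshold K, where the square is at least 1 / 4.\<close>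

lemma V_lower_bound:
  assumes "q\<^sub>0 > 0"
  obtains v where "v > 0" "\<And>q. q \<ge> q\<^sub>0 \<Longrightarrow> V \<phi> q \<ge> v"
proof -
  obtain K where K: "K > 0" "\<And>x. x \<ge> K \<Longrightarrow> \<phi> x \<ge> 1 / 2" using tanh_threshold by blast
  define m where "m = K / sqrt q\<^sub>0"
  have m: "m > 0" using K assms by (simp add: m_def)
  show ?thesis
  proof (rule that)
    show "1 / 4 * std_normal_density (m + 1) > 0" by (simp add: normal_density_pos)
    fix q assume q: "q \<ge> q\<^sub>0"
    have "1 / 4 * std_normal_density (m + 1) \<le> 1 / 4 * measure N {m..m + 1}"
      using measure_std_interval_ge[of m "m + 1" "m + 1"] m by simp
    also have "\<dots> = (\<integral>u. 1 / 4 * indicator {m..m + 1} u \<partial>N)" by simp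
    also have "\<dots> \<le> V \<phi> q" unfolding V_eq
    proof (rule integral_mono[OF _ V_integrable])
      show "integrable N (\<lambda>u. 1 / 4 * indicator {m..m + 1} u :: real)"
        by (rule integrable_std_bounded[where B=1]) (auto simp: indicator_def)
      show "1 / 4 * indicator {m..m + 1} u \<le> (\<phi> (sqrt q * u))\<^sup>2" for u
      proof (cases "u \<in> {m..m + 1}")
        case True
        have "K = sqrt q\<^sub>0 * m" using assms by (simp add: m_def)
        also have "\<dots> \<le> sqrt q * u" using True q m assms by (intro mult_mono) auto
        finally have "\<phi> (sqrt q * u) \<ge> 1 / 2" by (rule K(2))
        from power_mono[OF this, of 2] show ?thesis using True by (simp add: power2_eq_square)
      qed simp
    qed
    finally show "1 / 4 * std_normal_density (m + 1) \<le> V \<phi> q" .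
  qed
qed

lemma W_nonneg:
  assumes "0 \<le> \<nu>" "\<nu> \<le> \<rho>"
  shows "0 \<le> W \<phi> \<rho> \<nu>"
proof (cases "\<nu> = \<rho>")
  case True
  then show ?thesis using W_diag V_nonneg by simp
next
  case False
  then have rn: "0 \<le> \<nu>" "\<nu> < \<rho>" using assms by auto
  have nn: "0 \<le> y * \<phi> (k * y)" if "k \<ge> 0" for k y
  proof (cases "y \<ge> 0")
    case True then show ?thesis using that tanh_nonneg[of "k * y"] by simp
  next
    case False
    then have "0 \<le> \<phi> (k * - y)" using that by (intro tanh_nonneg) (auto simp: mult_nonneg_nonpos)
    then show ?thesis using False tanh_minus[of "k * y"] by (simp add: mult_nonpos_nonpos)
  qed
  have c: "0 \<le> \<nu> / \<rho>" "\<nu> / \<rho> < 1" using rn by auto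
  show ?thesis
    by (rule order_trans[OF _ W_ge_mult[OF rn]],
        intro mult_nonneg_nonneg Bochner_Integration.integral_nonneg divide_nonneg_nonneg nn)
      (use rn less_imp_le[OF sqrt_one_minus_square_pos[OF c]] in simp_all)
qed

lemma W_le_V:
  assumes "0 \<le> \<nu>" "\<nu> \<le> \<rho>"
  shows "W \<phi> \<rho> \<nu> \<le> V \<phi> \<rho>"
proof (cases "\<nu> = \<rho>")
  case True
  then show ?thesis using W_diag by simp
next
  case False
  then have "0 \<le> V \<phi> \<rho> - W \<phi> \<rho> \<nu>" using assms
    by (subst V_minus_W) (auto intro!: Bochner_Integration.integral_nonneg)
  then show ?thesis by simp
qed

text \<open>On the box |u| \<le> t, m \<le> v \<le> m + 1 the component z is at least K and z' at
  most -K, so the values of \<phi> differ by at least 1. The box has mass of order t = b / sqrt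
  \<rho>, which is the square root. The lower bound d on \<rho> - \<nu> keeps b large enough for a
  fixed m.\<close>

lemma V_minus_W_lower_bound:
  assumes d: "d > 0"
  obtains k where "k > 0"
    "\<And>\<rho> \<nu>. 0 \<le> \<nu> \<Longrightarrow> d \<le> \<rho> - \<nu> \<Longrightarrow> V \<phi> \<rho> - W \<phi> \<rho> \<nu> \<ge> k * sqrt ((\<rho> - \<nu>) / \<rho>)"
proof -
  obtain K where K: "K > 0" "\<And>x. x \<ge> K \<Longrightarrow> \<phi> x \<ge> 1 / 2" using tanh_threshold by blast
  \<comment> \<open>The quotient brings b v up to K; the extra 1 pays for |a u| \<le> b.\<close>
  define m where "m = K / sqrt (d / 2) + 1"
  have m: "m > 1" using K d by (simp add: m_def)
  \<comment> \<open>The width 2 t of the u-interval cancels the factor 1 / 2 of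
    \<open>V_minus_W\<close>, and sqrt 2 comes from t = sqrt ((\<rho> - \<nu>) / (2 \<rho>)). The
    densities are taken at the largest moduli, using t \<le> 1.\<close>
  define k where "k = std_normal_density 1 * std_normal_density (m + 1) / sqrt 2"
  show ?thesis
  proof (rule that)
    show "k > 0" by (simp add: k_def normal_density_pos)
    fix \<rho> \<nu> :: real assume n: "0 \<le> \<nu>" and rd: "d \<le> \<rho> - \<nu>"
    have rn: "\<nu> < \<rho>" and r: "\<rho> > 0" using n rd d by auto
    define a where "a = sqrt ((\<rho> + \<nu>) / 2)"
    define b where "b = sqrt ((\<rho> - \<nu>) / 2)"
    define t where "t = b / sqrt \<rho>"
    have a: "0 \<le> a" "a \<le> sqrt \<rho>" using n rn r by (auto simp: a_def)
    have b: "sqrt (d / 2) \<le> b" "b \<le> sqrt \<rho>" "b > 0" using n rn r rd d by (auto simp: b_def)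
    have t: "0 \<le> t" "t \<le> 1" using b r by (auto simp: t_def)
    have tb: "sqrt ((\<rho> - \<nu>) / \<rho>) / sqrt 2 = t"
      by (simp add: t_def b_def real_sqrt_divide[symmetric] del: real_sqrt_divide)
    let ?A = "{-t..t}" and ?B = "{m..m + 1}"
    let ?f = "\<lambda>(u, v). (\<phi> (a * u + b * v) - \<phi> (a * u - b * v))\<^sup>2 / 2"
    have pw: "1 / 2 * indicator (?A \<times> ?B) p \<le> ?f p" for p
    proof (cases "p \<in> ?A \<times> ?B")
      case True
      then obtain u v where p: "p = (u, v)" and u: "\<bar>u\<bar> \<le> t" and v: "m \<le> v" by (auto simp: abs_le_iff)
      have "\<bar>a * u\<bar> \<le> sqrt \<rho> * t" using a u r unfolding abs_mult by (intro mult_mono) auto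
      also have "\<dots> = b" using r by (simp add: t_def)
      finally have au: "\<bar>a * u\<bar> \<le> b" .
      have "K \<le> b * (K / sqrt (d / 2))" using b K d by (simp add: pos_le_divide_eq)
      then have "K + b \<le> b * m" unfolding m_def by (simp add: algebra_simps)
      also have "\<dots> \<le> b * v" using v b by simp
      finally have "K + \<bar>a * u\<bar> \<le> b * v" using au by simp
      then have "K \<le> a * u + b * v" "K \<le> - (a * u - b * v)" by linarith+
      then have "\<phi> (a * u + b * v) \<ge> 1 / 2" "\<phi> (- (a * u - b * v)) \<ge> 1 / 2" by (blast intro: K(2))+
      then have "1 \<le> \<phi> (a * u + b * v) - \<phi> (a * u - b * v)" unfolding tanh_minus by simp
      from power_mono[OF this, of 2] show ?thesis using True p by simp
    qed (auto simp: case_prod_beta')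
    have "k * sqrt ((\<rho> - \<nu>) / \<rho>) = 1 / 2 * ((std_normal_density 1 * (t - - t)) * (std_normal_density (m + 1) * (m + 1 - m)))"
      unfolding k_def tb[symmetric] by (simp add: field_simps)
    also have "\<dots> \<le> 1 / 2 * (measure N ?A * measure N ?B)"
      using t m by (intro mult_left_mono mult_mono measure_std_interval_ge) auto
    also have "measure N ?A * measure N ?B = measure (N \<Otimes>\<^sub>M N) (?A \<times> ?B)"
      by (simp add: measure_def N.emeasure_pair_measure_Times enn2real_mult)
    also have "1 / 2 * measure (N \<Otimes>\<^sub>M N) (?A \<times> ?B) = (\<integral>p. 1 / 2 * indicator (?A \<times> ?B) p \<partial>(N \<Otimes>\<^sub>M N))"
      by (simp add: space_pair_measure)
    also have "\<dots> \<le> (\<integral>p. ?f p \<partial>(N \<Otimes>\<^sub>M N))"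
    proof (rule integral_mono[OF _ _ pw])
      show "integrable (N \<Otimes>\<^sub>M N) (\<lambda>p. 1 / 2 * indicator (?A \<times> ?B) p :: real)"
        by (rule integrable_std_pair_bounded[where B=1]) (auto simp: indicator_def)
      have "\<bar>\<phi> x - \<phi> y\<bar> \<le> 2" for x y using tanh_abs_le[of x] tanh_abs_le[of y] by linarith
      then have "(\<phi> x - \<phi> y)\<^sup>2 \<le> 2\<^sup>2" for x y
        unfolding abs_le_square_iff[symmetric] by simp
      then show "integrable (N \<Otimes>\<^sub>M N) ?f"
        by (intro integrable_std_pair_bounded[where B=2]) (auto simp: case_prod_beta')
    qed
    also have "\<dots> = V \<phi> \<rho> - W \<phi> \<rho> \<nu>"
      unfolding V_minus_W[OF n rn] a_def b_def ..
    finally show "k * sqrt ((\<rho> - \<nu>) / \<rho>) \<le> V \<phi> \<rho> - W \<phi> \<rho> \<nu>" .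
  qed
qed

section \<open>Limits as the variance tends to infinity\<close>

lemma tanh_sgn_limit:
  fixes k :: "nat \<Rightarrow> real"
  assumes "filterlim k at_top sequentially"
  shows "(\<lambda>n. \<phi> (k n * y)) \<longlonglongrightarrow> sgn y"
proof -
  have pos: "(\<lambda>n. \<phi> (k n * y)) \<longlonglongrightarrow> 1" if "y > 0" for y
    using that by (intro filterlim_compose[OF tanh_limit] filterlim_at_top_mult_tendsto_pos[OF tendsto_const _ assms]
      filterlim_at_top_mult_tendsto_pos)
      (use filterlim_tendsto_pos_mult_at_top[OF tendsto_const that assms] in \<open>simp add: mult.commute\<close>)
  consider "y > 0" | "y = 0" | "y < 0" by linarith
  then show ?thesis
  proof cases
    case 3
    then have "(\<lambda>n. - \<phi> (k n * - y)) \<longlonglongrightarrow> - 1" by (intro tendsto_minus pos) simp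
    then show ?thesis using 3 by (simp add: tanh_minus)
  qed (use pos in \<open>auto simp: tanh_0\<close>)
qed

lemma V_tendsto_1:
  fixes q :: "nat \<Rightarrow> real"
  assumes "filterlim q at_top sequentially"
  shows "(\<lambda>n. V \<phi> (q n)) \<longlonglongrightarrow> 1"
proof -
  have k: "filterlim (\<lambda>n. sqrt (q n)) at_top sequentially"
    by (rule filterlim_compose[OF sqrt_at_top assms])
  have "(\<lambda>n. \<integral>u. (\<phi> (sqrt (q n) * u))\<^sup>2 \<partial>N) \<longlonglongrightarrow> (\<integral>u. 1 \<partial>N)"
  proof (rule integral_dominated_convergence[where w="\<lambda>_. 1"])
    show "AE u in N. (\<lambda>n. (\<phi> (sqrt (q n) * u))\<^sup>2) \<longlonglongrightarrow> 1"
    proof (rule eventually_mono[OF AE_std_nonzero])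
      fix u :: real assume "u \<noteq> 0"
      then show "(\<lambda>n. (\<phi> (sqrt (q n) * u))\<^sup>2) \<longlonglongrightarrow> 1"
        using tendsto_power[OF tanh_sgn_limit[OF k, of u], of 2] by (simp add: sgn_if split: if_splits)
    qed
  qed (auto simp: abs_square_le_1 tanh_abs_le)
  then show ?thesis using N.prob_space by (simp add: V_eq)
qed

text \<open>Both integrals in \<open>W_ge_mult\<close> tend to the mean of |X|, which is sqrt (2 /
  pi), by dominated convergence; their product is the slope 2 / pi.\<close>

lemma W_lower_slope:
  fixes \<rho> \<nu> :: "nat \<Rightarrow> real"
  assumes rho: "filterlim \<rho> at_top sequentially" and c: "(\<lambda>n. \<nu> n / \<rho> n) \<longlonglongrightarrow> 0"
    and rn: "\<And>n. 0 \<le> \<nu> n" "\<And>n. \<nu> n < \<rho> n" and \<kappa>: "\<kappa> < 2 / pi"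
  shows "eventually (\<lambda>n. W \<phi> (\<rho> n) (\<nu> n) \<ge> \<kappa> * (\<nu> n / \<rho> n)) sequentially"
proof -
  define \<tau> where "\<tau> n = sqrt (1 - (\<nu> n / \<rho> n)\<^sup>2)" for n
  define r where "r n = \<nu> n / \<rho> n / \<tau> n" for n
  define A where "A n = (\<integral>y. y * \<phi> (sqrt (\<rho> n) * \<tau> n * y) \<partial>N)" for n
  define B where "B n = (\<integral>x. exp (- (r n * x)\<^sup>2 / 2) * (x * \<phi> (sqrt (\<rho> n) * x)) \<partial>N)" for n
  have s: "filterlim (\<lambda>n. sqrt (\<rho> n)) at_top sequentially"
    by (rule filterlim_compose[OF sqrt_at_top rho])
  have "\<tau> \<longlonglongrightarrow> sqrt (1 - 0\<^sup>2)" unfolding \<tau>_def by (intro tendsto_intros c)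
  then have t: "\<tau> \<longlonglongrightarrow> 1" by simp
  have "r \<longlonglongrightarrow> 0 / 1" unfolding r_def by (intro tendsto_intros c t) simp
  then have r: "r \<longlonglongrightarrow> 0" by simp
  have k: "filterlim (\<lambda>n. sqrt (\<rho> n) * \<tau> n) at_top sequentially"
    using filterlim_tendsto_pos_mult_at_top[OF t _ s] by (simp add: mult.commute)
  have "A \<longlonglongrightarrow> (\<integral>y. \<bar>y\<bar> \<partial>N)" unfolding A_def
  proof (rule integral_dominated_convergence[where w="\<lambda>y. \<bar>y\<bar>"])
    show "AE y in N. (\<lambda>n. y * \<phi> (sqrt (\<rho> n) * \<tau> n * y)) \<longlonglongrightarrow> \<bar>y\<bar>"
      using tendsto_mult_left[OF tanh_sgn_limit[OF k]] by (auto simp: abs_sgn)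
    show "AE y in N. norm (y * \<phi> (sqrt (\<rho> n) * \<tau> n * y)) \<le> \<bar>y\<bar>" for n
      by (auto simp: abs_mult intro!: mult_left_le tanh_abs_le)
  qed (auto simp: integrable_std_abs)
  then have A: "A \<longlonglongrightarrow> sqrt (2 / pi)" by (simp only: integral_std_abs)
  have "B \<longlonglongrightarrow> (\<integral>y. \<bar>y\<bar> \<partial>N)" unfolding B_def
  proof (rule integral_dominated_convergence[where w="\<lambda>y. \<bar>y\<bar>"])
    have "(\<lambda>n. exp (- (r n * x)\<^sup>2 / 2) * (x * \<phi> (sqrt (\<rho> n) * x))) \<longlonglongrightarrow> exp (- (0 * x)\<^sup>2 / 2) * (x * sgn x)" for x
      by (intro tendsto_intros r tanh_sgn_limit[OF s]) auto
    then show "AE x in N. (\<lambda>n. exp (- (r n * x)\<^sup>2 / 2) * (x * \<phi> (sqrt (\<rho> n) * x))) \<longlonglongrightarrow> \<bar>x\<bar>"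
      by (simp add: abs_sgn)
    have "\<bar>exp (- (r n * x)\<^sup>2 / 2) * (x * \<phi> (sqrt (\<rho> n) * x))\<bar> \<le> 1 * (\<bar>x\<bar> * 1)" for n x
      unfolding abs_mult by (intro mult_mono) (auto simp: tanh_abs_le)
    then show "AE x in N. norm (exp (- (r n * x)\<^sup>2 / 2) * (x * \<phi> (sqrt (\<rho> n) * x))) \<le> \<bar>x\<bar>" for n by simp
  qed (auto simp: integrable_std_abs)
  then have B: "B \<longlonglongrightarrow> sqrt (2 / pi)" by (simp only: integral_std_abs)
  have "(\<lambda>n. A n * B n / \<tau> n) \<longlonglongrightarrow> sqrt (2 / pi) * sqrt (2 / pi) / 1"
    by (intro tendsto_intros A B t) simp
  then have "(\<lambda>n. A n * B n / \<tau> n) \<longlonglongrightarrow> 2 / pi" by simp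
  from order_tendstoD(1)[OF this \<kappa>] show ?thesis
  proof eventually_elim
    case (elim n)
    have "\<kappa> * (\<nu> n / \<rho> n) \<le> (A n * B n / \<tau> n) * (\<nu> n / \<rho> n)"
      using elim rn[of n] by (intro mult_right_mono) auto
    also have "\<dots> = r n * A n * B n" by (simp add: r_def mult_ac)
    also have "\<dots> \<le> W \<phi> (\<rho> n) (\<nu> n)"
      unfolding A_def B_def r_def \<tau>_def using rn by (intro W_ge_mult) auto
    finally show ?case .
  qed
qed

end

subsection \<open>The recursion\<close>

text \<open>Here \<open>Q n\<close> is q in layer n + 1, \<open>M n\<close> is |lam| in that layer,
  and \<open>w\<close> is \<open>\<sigma>w\<^sup>2\<close>. Inserting the recursions of p and gamma
  into q and lam closes the system; the bias enters only through the initial values.\<close>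

locale mean_field_recursion = tanh_nonlinearity +
  fixes w :: real and Q M :: "nat \<Rightarrow> real"
  assumes w: "w > 0"
    and Q_0: "Q 0 > 0" and M_0: "0 \<le> M 0" "M 0 \<le> Q 0"
    and Q_Suc: "Q (Suc n) = Q n + w * V \<phi> (Q n)"
    and M_Suc: "M (Suc n) = M n + w * W \<phi> (Q n) (M n)"
begin

lemma M_bounds: "0 \<le> M n \<and> M n \<le> Q n"
proof (induction n)
  case (Suc n)
  have "0 \<le> w * W \<phi> (Q n) (M n)" "w * W \<phi> (Q n) (M n) \<le> w * V \<phi> (Q n)"
    using Suc w W_nonneg[of "M n" "Q n"] W_le_V[of "M n" "Q n"] by auto
  then show ?case using Suc by (simp add: Q_Suc M_Suc)
qed (use M_0 in simp)

lemma M_nonneg: "0 \<le> M n" and M_le_Q: "M n \<le> Q n"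
  using M_bounds by auto

lemma Q_ge_Q_0: "Q 0 \<le> Q n"
proof (induction n)
  case (Suc n)
  then show ?case using V_nonneg[of "Q n"] w by (simp add: Q_Suc add_increasing2)
qed simp

lemma Q_pos: "Q n > 0"
  using Q_ge_Q_0[of n] Q_0 by linarith

lemma Q_le_affine: "Q n \<le> Q 0 + w * real n"
proof (induction n)
  case (Suc n)
  have "w * V \<phi> (Q n) \<le> w * 1" using V_le_1 w by (intro mult_left_mono) auto
  then show ?case using Suc by (simp add: Q_Suc algebra_simps)
qed simp

lemma Q_le: "Q n \<le> (Q 0 + w) * (real n + 1)"
proof -
  have "0 \<le> Q 0 * real n" using Q_0 by simp
  then show ?thesis using Q_le_affine[of n] w by (simp add: algebra_simps)
qed

text \<open>A crude slope valid from the start. The sharp slope w needs \<open>V\<close> near 1,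
  hence first that \<open>Q\<close> tends to infinity.\<close>

lemma Q_ge_linear: obtains v where "v > 0" "\<And>n. Q n \<ge> Q 0 + v * real n"
proof -
  obtain v where v: "v > 0" "\<And>q. q \<ge> Q 0 \<Longrightarrow> V \<phi> q \<ge> v"
    using V_lower_bound[OF Q_0] by blast
  show ?thesis
  proof (rule that)
    show "w * v > 0" using w v by simp
    show "Q n \<ge> Q 0 + w * v * real n" for n
    proof (induction n)
      case (Suc n)
      have "w * v \<le> w * V \<phi> (Q n)" using v(2)[OF Q_ge_Q_0] w by (intro mult_left_mono) auto
      then show ?case using Suc by (simp add: Q_Suc algebra_simps)
    qed simp
  qed
qed

lemma Q_at_top: "filterlim Q at_top sequentially"
proof -
  obtain v where v: "v > 0" "\<And>n. Q n \<ge> Q 0 + v * real n" using Q_ge_linear by blast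
  have vn: "Q n \<ge> v * real n" for n using v(2)[of n] Q_0 by linarith
  have "filterlim (\<lambda>n. v * real n) at_top sequentially"
    using v(1) by (intro filterlim_tendsto_pos_mult_at_top[OF tendsto_const] filterlim_real_sequentially)
  then show ?thesis
    by (rule filterlim_at_top_mono) (use vn in simp)
qed

lemma Q_eventually_ge:
  assumes "\<kappa> < 1"
  shows "eventually (\<lambda>n. Q n \<ge> \<kappa> * w * real n) sequentially"
proof -
  \<comment> \<open>The slack between the two slopes absorbs the first m layers.\<close>
  obtain \<kappa>' where k: "\<kappa> < \<kappa>'" "\<kappa>' < 1" using dense[OF assms] by blast
  have "eventually (\<lambda>n. V \<phi> (Q n) > \<kappa>') sequentially"
    using V_tendsto_1[OF Q_at_top] k(2) by (rule order_tendstoD)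
  then obtain m where m: "\<And>n. n \<ge> m \<Longrightarrow> V \<phi> (Q n) > \<kappa>'" by (auto simp: eventually_sequentially)
  have ge: "Q n \<ge> \<kappa>' * w * (real n - real m)" if "n \<ge> m" for n
    using that
  proof (induction n rule: dec_induct)
    case base
    then show ?case using Q_pos[of m] by simp
  next
    case (step n)
    have "w * \<kappa>' \<le> w * V \<phi> (Q n)" using m[OF step(1)] w by (intro mult_left_mono) auto
    then show ?case using step by (simp add: Q_Suc algebra_simps)
  qed
  from eventually_real_ge[of "\<kappa>' * real m / (\<kappa>' - \<kappa>)"] eventually_ge_at_top[of m]
  show ?thesis
  proof eventually_elim
    case (elim n)
    then have "\<kappa>' * real m \<le> (\<kappa>' - \<kappa>) * real n" using k by (simp add: pos_divide_le_eq mult.commute)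
    then have "w * (\<kappa> * real n) \<le> w * (\<kappa>' * (real n - real m))"
      using w by (intro mult_left_mono) (auto simp: algebra_simps)
    then show ?case using ge[OF elim(2)] by (simp add: algebra_simps)
  qed
qed

lemma Q_eventually_le:
  assumes "\<kappa> > 1"
  shows "eventually (\<lambda>n. Q n \<le> \<kappa> * w * real n) sequentially"
  using eventually_real_ge[of "Q 0 / ((\<kappa> - 1) * w)"]
proof eventually_elim
  case (elim n)
  then have "Q 0 \<le> (\<kappa> - 1) * w * real n" using assms w by (simp add: pos_divide_le_eq mult.commute)
  then show ?case using Q_le_affine[of n] by (simp add: algebra_simps)
qed

text \<open>If the gap is at least \<delta> (n + 1) while \<open>Q n\<close> is at most C (n + 1),
  the relative gap is at least \<delta> / C and the next increment at least w k sqrt (\<delta> / C).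
  This exceeds \<delta> once \<delta> is small. An increment linear in the relative gap would
  instead demand w k \<ge> C, whatever \<delta> is.\<close>

lemma gap_linear:
  assumes "M 0 < Q 0"
  obtains \<delta> where "\<delta> > 0" "\<And>n. Q n - M n \<ge> \<delta> * (real n + 1)"
proof -
  define d where "d = Q 0 - M 0"
  have d: "d > 0" using assms by (simp add: d_def)
  obtain k where k: "k > 0"
    "\<And>\<rho> \<nu>. 0 \<le> \<nu> \<Longrightarrow> d \<le> \<rho> - \<nu> \<Longrightarrow> V \<phi> \<rho> - W \<phi> \<rho> \<nu> \<ge> k * sqrt ((\<rho> - \<nu>) / \<rho>)"
    using V_minus_W_lower_bound[OF d] by blast
  define C where "C = Q 0 + w"
  have C: "C > 0" using Q_0 w by (simp add: C_def)
  \<comment> \<open>The second bound makes the increment \<open>w * k * sqrt (\<delta> / C)\<close> at least \<open>\<delta>\<close>.\<close>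
  define \<delta> where "\<delta> = min d ((w * k)\<^sup>2 / C)"
  have \<delta>: "\<delta> > 0" "\<delta> \<le> d" "\<delta> \<le> (w * k)\<^sup>2 / C" using d w k C by (auto simp: \<delta>_def)
  have incr: "\<delta> \<le> w * k * sqrt (\<delta> / C)"
  proof (rule power2_le_imp_le)
    have "\<delta>\<^sup>2 \<le> (w * k)\<^sup>2 / C * \<delta>" using \<delta> unfolding power2_eq_square[of \<delta>] by (intro mult_right_mono) auto
    also have "\<dots> = (w * k * sqrt (\<delta> / C))\<^sup>2" using \<delta> C by (simp add: power_mult_distrib)
    finally show "\<delta>\<^sup>2 \<le> (w * k * sqrt (\<delta> / C))\<^sup>2" .
    show "0 \<le> w * k * sqrt (\<delta> / C)" using w k \<delta> C by simp
  qed
  \<comment> \<open>The first conjunct is carried along because \<open>k\<close> is valid only for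
    gaps of at least d.\<close>
  have "d \<le> Q n - M n \<and> \<delta> * (real n + 1) \<le> Q n - M n" for n
  proof (induction n)
    case 0
    then show ?case using \<delta> by (simp add: d_def)
  next
    case (Suc n)
    have "\<delta> / C = \<delta> * (real n + 1) / (C * (real n + 1))" by simp
    also have "\<dots> \<le> (Q n - M n) / Q n"
      using Suc \<delta> Q_le[of n] Q_pos[of n] M_le_Q[of n] by (intro frac_le) (auto simp: C_def)
    finally have "w * (k * sqrt (\<delta> / C)) \<le> w * (k * sqrt ((Q n - M n) / Q n))"
      using w k by (intro mult_left_mono) auto
    also have "\<dots> \<le> w * (V \<phi> (Q n) - W \<phi> (Q n) (M n))"
      using w Suc by (intro mult_left_mono k(2) M_nonneg) auto
    finally have "\<delta> \<le> w * (V \<phi> (Q n) - W \<phi> (Q n) (M n))" using incr by simp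
    then show ?case using Suc \<delta> by (simp add: Q_Suc M_Suc algebra_simps)
  qed
  then show ?thesis using that \<delta>(1) by blast
qed

text \<open>The larger exponent pays for \<open>Q n\<close> being only eventually above (\<kappa> /
  \<kappa>') w n, which turns w \<kappa> / \<open>Q n\<close> into at most \<kappa>' / n.\<close>

lemma M_bigo_of_slope:
  assumes k: "0 < \<kappa>" "\<kappa> < \<kappa>'"
    and W: "eventually (\<lambda>n. W \<phi> (Q n) (M n) \<le> \<kappa> * (M n / Q n)) sequentially"
  shows "M \<in> O(\<lambda>n. real n powr \<kappa>')"
proof (rule growth_upper[OF M_nonneg])
  show "0 \<le> \<kappa>'" using k by simp
  have "\<kappa> / \<kappa>' < 1" using k by simp
  from W Q_eventually_ge[OF this] eventually_gt_at_top[of 0]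
  show "eventually (\<lambda>n. M (Suc n) \<le> M n * (1 + \<kappa>' / real n)) sequentially"
  proof eventually_elim
    case (elim n)
    have "\<kappa> * w * real n \<le> \<kappa>' * Q n" using elim(2) k by (simp add: field_simps)
    then have "w * \<kappa> / Q n \<le> \<kappa>' / real n" using elim(3) Q_pos[of n] by (simp add: field_simps)
    then have "M n * (w * \<kappa> / Q n) \<le> M n * (\<kappa>' / real n)" by (intro mult_left_mono M_nonneg)
    moreover have "w * W \<phi> (Q n) (M n) \<le> w * (\<kappa> * (M n / Q n))"
      using elim(1) w by (intro mult_left_mono) auto
    ultimately show ?case by (simp add: M_Suc algebra_simps)
  qed
qed

lemma M_bigomega_of_slope:
  assumes k: "0 < \<kappa>" "\<kappa> < \<kappa>'" "\<kappa>' \<le> 1" and M0: "M 0 > 0"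
    and W: "eventually (\<lambda>n. W \<phi> (Q n) (M n) \<ge> \<kappa>' * (M n / Q n)) sequentially"
  shows "M \<in> \<Omega>(\<lambda>n. real n powr \<kappa>)"
proof (rule growth_lower)
  show "M n > 0" for n
  proof (induction n)
    case (Suc n)
    have "0 \<le> w * W \<phi> (Q n) (M n)" using w W_nonneg[OF M_nonneg M_le_Q] by simp
    then show ?case using Suc by (simp add: M_Suc)
  qed (use M0 in simp)
  show "0 \<le> \<kappa>" "\<kappa> \<le> 1" using k by auto
  have "\<kappa>' / \<kappa> > 1" using k by simp
  from W Q_eventually_le[OF this] eventually_gt_at_top[of 0]
  show "eventually (\<lambda>n. M (Suc n) \<ge> M n * (1 + \<kappa> / real n)) sequentially"
  proof eventually_elim
    case (elim n)
    have "\<kappa> * Q n \<le> \<kappa>' * w * real n" using elim(2) k by (simp add: field_simps)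
    then have "\<kappa> / real n \<le> w * \<kappa>' / Q n" using elim(3) Q_pos[of n] by (simp add: field_simps)
    then have "M n * (\<kappa> / real n) \<le> M n * (w * \<kappa>' / Q n)" by (intro mult_left_mono M_nonneg)
    moreover have "w * W \<phi> (Q n) (M n) \<ge> w * (\<kappa>' * (M n / Q n))"
      using elim(1) w by (intro mult_left_mono) auto
    ultimately show ?case by (simp add: M_Suc algebra_simps)
  qed
qed

lemma ratio_tendsto_0:
  assumes less: "M 0 < Q 0"
  shows "(\<lambda>n. M n / Q n) \<longlonglongrightarrow> 0"
proof -
  obtain \<delta> where \<delta>: "\<delta> > 0" "\<And>n. Q n - M n \<ge> \<delta> * (real n + 1)" using gap_linear[OF less] by blast
  \<comment> \<open>Dividing the linear gap by the linear upper bound on \<open>Q\<close> gives the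
    second entry; 1 / 2 keeps \<eta> below 1, as the chord bound requires.\<close>
  define \<eta> where "\<eta> = min (1 / 2) (\<delta> / (Q 0 + w))"
  have \<eta>: "0 < \<eta>" "\<eta> < 1" "\<eta> \<le> \<delta> / (Q 0 + w)" using \<delta>(1) Q_0 w by (auto simp: \<eta>_def)
  have c: "M n / Q n \<le> 1 - \<eta>" "M n < Q n" for n
  proof -
    have "\<eta> * Q n \<le> \<delta> / (Q 0 + w) * ((Q 0 + w) * (real n + 1))"
      using \<eta> \<delta>(1) Q_le[of n] Q_pos[of n] Q_0 w by (intro mult_mono) auto
    also have "\<dots> = \<delta> * (real n + 1)" using Q_0 w by simp
    also have "\<dots> \<le> Q n - M n" by (rule \<delta>(2))
    finally have g: "\<eta> * Q n \<le> Q n - M n" .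
    then have "M n \<le> (1 - \<eta>) * Q n" by (simp add: algebra_simps)
    then show "M n / Q n \<le> 1 - \<eta>" using Q_pos[of n] by (simp only: pos_divide_le_eq)
    show "M n < Q n" using g mult_pos_pos[OF \<eta>(1) Q_pos[of n]] by linarith
  qed
  obtain \<kappa> where k: "0 < \<kappa>" "\<kappa> < 1" "\<And>c. 0 \<le> c \<Longrightarrow> c \<le> 1 - \<eta> \<Longrightarrow> 2 / pi * arcsin c \<le> \<kappa> * c"
    using arcsin_chord_bound[OF \<eta>(1,2)] by blast
  obtain \<kappa>' where k': "\<kappa> < \<kappa>'" "\<kappa>' < 1" using dense[OF k(2)] by blast
  have "W \<phi> (Q n) (M n) \<le> \<kappa> * (M n / Q n)" for n
    using W_le_arcsin[OF M_nonneg c(2), of n] k(3)[OF _ c(1), of n] M_nonneg[of n] Q_pos[of n]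
    by (simp add: less_imp_le)
  then have "M \<in> O(\<lambda>n. real n powr \<kappa>')" using M_bigo_of_slope[OF k(1) k'(1)] by simp
  then obtain B where B: "eventually (\<lambda>n. norm (M n) \<le> B * norm (real n powr \<kappa>')) sequentially"
    by (elim landau_o.bigE)
  obtain v where v: "v > 0" "\<And>n. Q n \<ge> Q 0 + v * real n" using Q_ge_linear by blast
  have vn: "Q n \<ge> v * real n" for n using v(2)[of n] Q_0 by linarith
  show ?thesis
  proof (rule Lim_null_comparison)
    show "(\<lambda>n. B / v * real n powr (\<kappa>' - 1)) \<longlonglongrightarrow> 0"
      using k' by (intro tendsto_mult_right_zero tendsto_neg_powr filterlim_real_sequentially) simp
    show "eventually (\<lambda>n. norm (M n / Q n) \<le> B / v * real n powr (\<kappa>' - 1)) sequentially"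
      using B eventually_gt_at_top[of 0]
    proof eventually_elim
      case (elim n)
      have "M n / Q n \<le> (B * real n powr \<kappa>') / (v * real n)"
        using elim M_nonneg[of n] v(1) vn[of n] by (intro frac_le) auto
      also have "\<dots> = B / v * real n powr (\<kappa>' - 1)" using elim by (simp add: powr_diff)
      finally show ?case using M_nonneg[of n] Q_pos[of n] by simp
    qed
  qed
qed

text \<open>The second use of the arcsin bound: now that the ratio tends to 0, any slope above 2 /
  pi is eventually valid.\<close>

lemma M_bigo:
  assumes less: "M 0 < Q 0" and k: "2 / pi < \<kappa>"
  shows "M \<in> O(\<lambda>n. real n powr \<kappa>)"
proof -
  obtain \<kappa>' where k': "2 / pi < \<kappa>'" "\<kappa>' < \<kappa>" using dense[OF k] by blast
  have p: "2 / pi > (0 :: real)" by simp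
  obtain \<delta> where \<delta>: "\<delta> > 0" "\<And>n. Q n - M n \<ge> \<delta> * (real n + 1)" using gap_linear[OF less] by blast
  have lt: "M n < Q n" for n using \<delta>(2)[of n] mult_pos_pos[OF \<delta>(1), of "real n + 1"] by simp
  have "\<kappa>' / (2 / pi) > 1" using k' p by (simp only: less_divide_eq_1_pos)
  from arcsin_small_bound[OF ratio_tendsto_0[OF less] _ this]
  have "eventually (\<lambda>n. arcsin (M n / Q n) \<le> \<kappa>' / (2 / pi) * (M n / Q n)) sequentially"
    using M_nonneg less_imp_le[OF Q_pos] by simp
  then have "eventually (\<lambda>n. W \<phi> (Q n) (M n) \<le> \<kappa>' * (M n / Q n)) sequentially"
  proof eventually_elim
    case (elim n)
    from mult_left_mono[OF this less_imp_le[OF p]]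
    show ?case using W_le_arcsin[OF M_nonneg lt, of n] by simp
  qed
  moreover have "0 < \<kappa>'" using k'(1) p by linarith
  ultimately show ?thesis using k'(2) by (intro M_bigo_of_slope[of \<kappa>'])
qed

lemma M_bigomega:
  assumes less: "M 0 < Q 0" and pos: "M 0 > 0" and k: "0 < \<kappa>" "\<kappa> < 2 / pi"
  shows "M \<in> \<Omega>(\<lambda>n. real n powr \<kappa>)"
proof -
  obtain \<kappa>' where k': "\<kappa> < \<kappa>'" "\<kappa>' < 2 / pi" using dense[OF k(2)] by blast
  obtain \<delta> where \<delta>: "\<delta> > 0" "\<And>n. Q n - M n \<ge> \<delta> * (real n + 1)" using gap_linear[OF less] by blast
  have lt: "M n < Q n" for n using \<delta>(2)[of n] mult_pos_pos[OF \<delta>(1), of "real n + 1"] by simp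
  have "2 / pi \<le> 1" using pi_ge_two by simp
  then have "\<kappa>' \<le> 1" using k'(2) by linarith
  then show ?thesis
    using W_lower_slope[OF Q_at_top ratio_tendsto_0[OF less] M_nonneg lt k'(2)] k k' pos
    by (intro M_bigomega_of_slope[of \<kappa> \<kappa>']) auto
qed

end

section \<open>Transfer to the network quantities\<close>

context tanh_nonlinearity
begin

text \<open>Both q and lam equal \<open>\<sigma>b\<^sup>2\<close> in every layer, so p and gamma
  receive the same increment \<open>V\<close> and s is constant. Positivity of \<sigma>b makes this
  increment positive.\<close>

lemma rrn_sw_zero:
  assumes rrn: "rrn_mean_field \<phi> 0 \<sigma>b x x' p q \<gamma> lam"
    and p_pos: "p 0 > 0" and less: "\<gamma> 0 < p 0"
    and e: "\<And>l. e l = \<gamma> l / p l" and s: "\<And>l. s l = p l - \<gamma> l"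
  shows "(\<forall>l. \<gamma> l = real l * W \<phi> (\<sigma>b\<^sup>2) (\<sigma>b\<^sup>2) + \<gamma> 0) \<and>
       (\<forall>l. \<gamma> l = real l * V \<phi> (\<sigma>b\<^sup>2) + \<gamma> 0) \<and>
       (\<forall>l\<ge>1. lam l = \<sigma>b\<^sup>2) \<and>
       (\<sigma>b > 0 \<longrightarrow> e \<longlonglongrightarrow> 1 \<and> (\<lambda>l. 1 - e l) \<in> \<Theta>(\<lambda>l. 1 / real l)) \<and>
       (\<forall>l. s l = p l * (1 - e l)) \<and> s \<in> \<Theta>(\<lambda>l. 1)"
proof -
  let ?v = "V \<phi> (\<sigma>b\<^sup>2)"
  have WV: "W \<phi> (\<sigma>b\<^sup>2) (\<sigma>b\<^sup>2) = ?v" by (rule W_diag)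
  have rec: "p (Suc n) = ?v + p n" "\<gamma> (Suc n) = ?v + \<gamma> n" and lam: "l \<ge> 1 \<Longrightarrow> lam l = \<sigma>b\<^sup>2" for n l
    using rrn WV unfolding rrn_mean_field_def by (auto dest: spec[of _ "Suc n"])
  have p: "p l = real l * ?v + p 0" and g: "\<gamma> l = real l * ?v + \<gamma> 0" for l
    by (induction l) (simp_all add: rec algebra_simps)
  have v: "?v \<ge> 0" by (rule V_nonneg)
  have pp: "p l > 0" for l using p_pos v by (subst p) (auto intro: add_nonneg_pos)
  have s': "s l = p 0 - \<gamma> 0" for l unfolding s by (subst p, subst g) simp
  have e': "1 - e l = (p 0 - \<gamma> 0) / p l" for l
  proof -
    have "1 - e l = (p l - \<gamma> l) / p l" using pp[of l] by (simp add: e diff_divide_distrib)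
    then show ?thesis using s'[of l] by (simp only: s)
  qed
  have "e \<longlonglongrightarrow> 1 \<and> (\<lambda>l. 1 - e l) \<in> \<Theta>(\<lambda>l. 1 / real l)" if "\<sigma>b > 0"
  proof
    have "\<sigma>b\<^sup>2 > 0" using that by simp
    then obtain v where "v > 0" "\<And>q. q \<ge> \<sigma>b\<^sup>2 \<Longrightarrow> V \<phi> q \<ge> v"
      using V_lower_bound by blast
    from this(1) this(2)[OF order_refl] have vpos: "?v > 0" by linarith
    have pT: "p \<in> \<Theta>(\<lambda>l. real l)"
    proof (rule bigtheta_realI[OF vpos])
      show "?v * real n \<le> p n" if "n \<ge> 1" for n using p_pos by (subst p) (simp add: mult.commute)
      show "p n \<le> (?v + p 0) * real n" if "n \<ge> 1" for n
        using p_pos that by (subst p) (simp add: algebra_simps)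
    qed
    have "(\<lambda>l. (p 0 - \<gamma> 0) / p l) \<in> \<Theta>(\<lambda>l. 1 / real l)"
      using less by (intro bigtheta_divide pT) simp
    then show T: "(\<lambda>l. 1 - e l) \<in> \<Theta>(\<lambda>l. 1 / real l)" by (simp only: e')
    have "(\<lambda>l. 1 / real l) \<longlonglongrightarrow> 0" by (rule lim_1_over_n)
    then have "(\<lambda>l. 1 / real l) \<in> o(\<lambda>_. 1)" by (intro smalloI_tendsto) auto
    with bigthetaD1[OF T] have "(\<lambda>l. 1 - e l) \<in> o(\<lambda>_. 1)" by (rule landau_o.big_small_trans)
    then have "(\<lambda>l. 1 - e l) \<longlonglongrightarrow> 0" using smalloD_tendsto by fastforce
    from tendsto_diff[OF tendsto_const[of 1] this] show "e \<longlonglongrightarrow> 1" by simp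
  qed
  moreover have "s l = p l * (1 - e l)" for l using pp[of l] by (simp add: e' s')
  moreover have "s \<in> \<Theta>(\<lambda>l. 1)" using less by (simp add: s'[abs_def])
  ultimately show ?thesis using g lam unfolding WV by blast
qed

lemma rrn_sw_pos:
  assumes w: "\<sigma>w > 0" and rrn: "rrn_mean_field \<phi> \<sigma>w \<sigma>b x x' p q \<gamma> lam"
    and p_pos: "p 0 > 0" and less: "\<gamma> 0 < p 0" and ge: "- p 0 \<le> \<gamma> 0"
    and e: "\<And>l. e l = \<gamma> l / p l" and s: "\<And>l. s l = p l - \<gamma> l"
  shows "((\<sigma>b > 0 \<or> e 0 \<noteq> -1) \<and> lam 1 \<noteq> 0 \<longrightarrow>
          \<gamma> \<in> Theta_check (\<lambda>l. real l powr (2 / pi)) \<and>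
          e \<in> Theta_check (\<lambda>l. real l powr (2 / pi - 1))) \<and>
       (\<sigma>b > 0 \<or> e 0 \<noteq> -1 \<longrightarrow> e \<longlonglongrightarrow> 0) \<and>
       s \<in> \<Theta>(p) \<and> p \<in> \<Theta>(\<lambda>l. real l) \<and> s \<in> \<Theta>(\<lambda>l. real l)"
proof -
  define w where "w = \<sigma>w\<^sup>2"
  define \<beta> where "\<beta> = \<sigma>b\<^sup>2"
  define Q where "Q n = q (Suc n)" for n
  define L where "L n = lam (Suc n)" for n
  \<comment> \<open>The sign of the first lam persists, since \<open>M\<close> stays
    nonnegative.\<close>
  define \<sigma> :: real where "\<sigma> = (if L 0 \<ge> 0 then 1 else -1)"
  define M where "M n = \<sigma> * L n" for n
  have w0: "w > 0" and b0: "\<beta> \<ge> 0" using w by (auto simp: w_def \<beta>_def)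
  have rec: "Q n = w * p n + \<beta>" "p (Suc n) = V \<phi> (Q n) + p n"
    "L n = w * \<gamma> n + \<beta>" "\<gamma> (Suc n) = W \<phi> (Q n) (L n) + \<gamma> n" for n
    using rrn unfolding rrn_mean_field_def Q_def L_def w_def \<beta>_def by (auto dest: spec[of _ "Suc n"])
  have \<sigma>: "\<sigma> = 1 \<or> \<sigma> = -1" by (simp add: \<sigma>_def)
  have W\<sigma>: "W \<phi> (Q n) (M n) = \<sigma> * W \<phi> (Q n) (L n)" for n
    using \<sigma> W_minus[of "Q n" "L n"] by (auto simp: M_def)
  have wg: "w * \<gamma> 0 < w * p 0" "- (w * p 0) \<le> w * \<gamma> 0"
    using less ge w0 mult_left_mono[OF ge, of w] by auto
  interpret mean_field_recursion \<phi> w Q M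
  proof
    show "w > 0" by fact
    show "Q 0 > 0" using p_pos w0 b0 by (simp add: rec add_pos_nonneg)
    show "0 \<le> M 0" by (simp add: M_def \<sigma>_def)
    show "M 0 \<le> Q 0" using wg b0 by (simp add: M_def \<sigma>_def rec)
    show "Q (Suc n) = Q n + w * V \<phi> (Q n)" for n
      unfolding rec(1)[of "Suc n"] rec(2) using rec(1)[of n] by (simp add: algebra_simps)
    have "L (Suc n) = L n + w * W \<phi> (Q n) (L n)" for n
      unfolding rec(3)[of "Suc n"] rec(4) using rec(3)[of n] by (simp add: algebra_simps)
    then show "M (Suc n) = M n + w * W \<phi> (Q n) (M n)" for n
      unfolding W\<sigma> by (simp add: M_def algebra_simps)
  qed
  have L: "L n = \<sigma> * M n" for n using \<sigma> by (auto simp: M_def)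
  have p: "p n = (Q n - \<beta>) / w" and g: "\<gamma> n = (\<sigma> * M n - \<beta>) / w" for n
    using rec(1,3)[of n] w0 L[of n] by (auto simp: field_simps)
  have s': "s n = (Q n - \<sigma> * M n) / w" for n unfolding s by (subst p, subst g) (simp add: diff_divide_distrib[symmetric])
  obtain v where v: "v > 0" "\<And>n. Q n \<ge> Q 0 + v * real n" using Q_ge_linear by blast
  define C where "C = 2 * (Q 0 + w)"
  have Q1: "Q n \<le> C * real n" if "n \<ge> 1" for n
  proof -
    have "(Q 0 + w) * (real n + 1) \<le> (Q 0 + w) * (2 * real n)" using that Q_0 w0 by (intro mult_left_mono) auto
    then show ?thesis using order_trans[OF Q_le[of n]] by (simp add: C_def mult_ac)
  qed
  have pT: "p \<in> \<Theta>(\<lambda>l. real l)"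
  proof (rule bigtheta_realI)
    show "v / w > 0" using v w0 by simp
    show "v / w * real n \<le> p n" for n
    proof -
      have "v * real n \<le> Q n - \<beta>" using v(2)[of n] rec(1)[of 0] mult_pos_pos[OF w0 p_pos] by linarith
      then show ?thesis using w0 by (simp add: p[of n] divide_right_mono)
    qed
    show "p n \<le> C / w * real n" if "n \<ge> 1" for n
      using Q1[OF that] b0 w0 by (simp add: p[of n] divide_right_mono)
  qed
  \<comment> \<open>For negative lam the difference is Q + M, linear already through Q. So s is
    linear even when \<open>M 0 = Q 0\<close>, where \<open>gap_linear\<close> does not
    apply.\<close>
  have "\<exists>a>0. \<forall>n. a * real n \<le> Q n - \<sigma> * M n"
  proof (cases "L 0 \<ge> 0")
    case True
    then have "\<sigma> = 1" by (simp add: \<sigma>_def)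
    have "M 0 < Q 0" using wg(1) \<open>\<sigma> = 1\<close> by (simp add: M_def rec)
    then obtain \<delta> where d: "\<delta> > 0" "\<And>n. Q n - M n \<ge> \<delta> * (real n + 1)" using gap_linear by blast
    have "\<delta> * real n \<le> Q n - M n" for n
      using d(2)[of n] d(1) unfolding distrib_left by linarith
    with \<open>\<sigma> = 1\<close> d(1) show ?thesis by (intro exI[of _ \<delta>]) simp
  next
    case False
    then have "\<sigma> = -1" by (simp add: \<sigma>_def)
    moreover have "v * real n \<le> Q n + M n" for n using v(2)[of n] M_nonneg[of n] Q_0 by linarith
    ultimately show ?thesis using v(1) by (intro exI[of _ v]) auto
  qed
  then obtain a where a: "a > 0" "\<And>n. a * real n \<le> Q n - \<sigma> * M n" by blast
  have sT: "s \<in> \<Theta>(\<lambda>l. real l)"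
  proof (rule bigtheta_realI)
    show "a / w > 0" using a w0 by simp
    show "a / w * real n \<le> s n" for n using a(2)[of n] w0 by (simp add: s' divide_right_mono)
    show "s n \<le> 2 * C / w * real n" if "n \<ge> 1" for n
    proof -
      have "Q n - \<sigma> * M n \<le> 2 * Q n" using \<sigma> M_le_Q[of n] M_nonneg[of n] by auto
      also have "\<dots> \<le> 2 * (C * real n)" using Q1[OF that] by (intro mult_left_mono) auto
      finally have "s n \<le> 2 * (C * real n) / w"
        using w0 unfolding s' by (intro divide_right_mono) auto
      then show ?thesis by (simp add: mult_ac)
    qed
  qed
  have M0: "M 0 < Q 0" if c: "\<sigma>b > 0 \<or> e 0 \<noteq> -1"
  proof -
    \<comment> \<open>For \<sigma> = -1 this is exactly M 0 < Q 0; for \<sigma> = 1 that inequality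
      is gamma 0 < p 0.\<close>
    have "w * (p 0 + \<gamma> 0) + 2 * \<beta> > 0"
    proof (cases "\<sigma>b > 0")
      case True
      then have "\<beta> > 0" by (simp add: \<beta>_def)
      then show ?thesis using ge w0 by (intro add_nonneg_pos) auto
    next
      case False
      then have "\<gamma> 0 \<noteq> - p 0" using c p_pos by (auto simp: e)
      then have "p 0 + \<gamma> 0 > 0" using ge by linarith
      then show ?thesis using w0 b0 by (simp add: add_pos_nonneg)
    qed
    then show ?thesis using wg(1) by (auto simp: M_def \<sigma>_def rec algebra_simps)
  qed
  have e0: "e \<longlonglongrightarrow> 0" if c: "\<sigma>b > 0 \<or> e 0 \<noteq> -1"
  proof -
    have bQ: "(\<lambda>n. \<beta> / Q n) \<longlonglongrightarrow> 0"
      by (rule tendsto_divide_0[OF tendsto_const filterlim_at_top_imp_at_infinity[OF Q_at_top]])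
    have "(\<lambda>n. (\<sigma> * (M n / Q n) - \<beta> / Q n) / (1 - \<beta> / Q n)) \<longlonglongrightarrow> (\<sigma> * 0 - 0) / (1 - 0)"
      by (intro tendsto_intros bQ ratio_tendsto_0[OF M0[OF c]]) simp
    moreover have "(\<sigma> * (M n / Q n) - \<beta> / Q n) / (1 - \<beta> / Q n) = e n" for n
    proof -
      have "(\<sigma> * (M n / Q n) - \<beta> / Q n) / (1 - \<beta> / Q n) = ((\<sigma> * M n - \<beta>) / Q n) / ((Q n - \<beta>) / Q n)"
        using Q_pos[of n] by (simp add: diff_divide_distrib)
      also have "\<dots> = (\<sigma> * M n - \<beta>) / (Q n - \<beta>)" using Q_pos[of n] by simp
      also have "\<dots> = e n" using w0 unfolding e by (subst p, subst g) simp
      finally show ?thesis .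
    qed
    ultimately show ?thesis by (simp only: diff_0_right div_by_1 mult_zero_right)
  qed
  have check: "\<gamma> \<in> Theta_check (\<lambda>l. real l powr (2 / pi)) \<and> e \<in> Theta_check (\<lambda>l. real l powr (2 / pi - 1))"
    if c: "\<sigma>b > 0 \<or> e 0 \<noteq> -1" and l1: "lam 1 \<noteq> 0"
  proof -
    have "L 0 \<noteq> 0" using l1 by (simp add: L_def)
    then have M_pos: "M 0 > 0" by (auto simp: M_def \<sigma>_def)
    have two_pi: "2 / pi > (0::real)" by simp
    have gamma: "\<gamma> = (\<lambda>n. \<sigma> / w * M n + - (\<beta> / w))" by (rule ext) (simp add: g diff_divide_distrib)
    have sw: "\<sigma> / w \<noteq> 0" using \<sigma> w0 by auto
    have up: "\<gamma> \<in> O(\<lambda>n. real n powr \<kappa>)" if "\<kappa> > 2 / pi" for \<kappa>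
    proof -
      have "\<kappa> > 0" using that two_pi by linarith
      then show ?thesis unfolding gamma
        using M_bigo[OF M0[OF c] that] sw
        by (intro sum_in_bigo landau_o.small_imp_big[OF const_smallo_powr]) auto
    qed
    have low: "\<gamma> \<in> \<Omega>(\<lambda>n. real n powr \<kappa>)" if "0 < \<kappa>" "\<kappa> < 2 / pi" for \<kappa>
    proof -
      have "(\<lambda>n. \<sigma> / w * M n) \<in> \<Omega>(\<lambda>n. real n powr \<kappa>)"
        using M_bigomega[OF M0[OF c] M_pos that] sw by simp
      \<comment> \<open>The bias offset is negligible because \<open>M\<close> is bounded below by a
        positive power; this is why \<kappa> > 0 is the floor.\<close>
      moreover from this have "(\<lambda>n. - (\<beta> / w)) \<in> o(\<lambda>n. \<sigma> / w * M n)"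
        using landau_o.small_big_trans[OF const_smallo_powr[OF that(1)]] by (simp only: bigomega_iff_bigo)
      ultimately show ?thesis unfolding gamma bigomega_iff_bigo
        by (subst landau_o.big.plus_absorb2)
    qed
    have div: "(\<lambda>n. real n powr \<kappa> / real n) = (\<lambda>n. real n powr (\<kappa> - 1))" for \<kappa>
      by (rule ext) (simp add: powr_diff)
    have pn: "eventually (\<lambda>n. p n \<noteq> 0) sequentially" "eventually (\<lambda>n. real n \<noteq> 0) sequentially"
      using eventually_nonzero_bigtheta[OF pT] eventually_gt_at_top[of "0::nat"]
      by (auto elim: eventually_mono)
    have e_eq: "e = (\<lambda>n. \<gamma> n / p n)" by (rule ext) (rule e)
    have eup: "e \<in> O(\<lambda>n. real n powr \<kappa>)" if "\<kappa> > 2 / pi - 1" for \<kappa>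
    proof -
      have "e \<in> O(\<lambda>n. real n powr (\<kappa> + 1) / real n)"
        unfolding e_eq using that pn bigthetaD2[OF pT]
        by (intro landau_o.big.divide up) (auto simp: bigomega_iff_bigo)
      then show ?thesis by (simp add: div)
    qed
    have elow: "e \<in> \<Omega>(\<lambda>n. real n powr \<kappa>)" if "-1 < \<kappa>" "\<kappa> < 2 / pi - 1" for \<kappa>
    proof -
      have "e \<in> \<Omega>(\<lambda>n. real n powr (\<kappa> + 1) / real n)"
        unfolding e_eq using that pn bigthetaD1[OF pT]
        by (intro landau_omega.big.divide low) (auto simp: bigomega_iff_bigo)
      then show ?thesis by (simp add: div)
    qed
    show ?thesis
      using Theta_checkI[OF up low two_pi] Theta_checkI[OF eup elow] two_pi by simp
  qed
  have "s \<in> \<Theta>(p)"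
    by (rule landau_theta.trans[OF sT]) (use pT in \<open>simp add: bigtheta_sym\<close>)
  then show ?thesis using check e0 pT sT by blast
qed

end

theorem theoremB4:
  fixes \<phi> :: "real \<Rightarrow> real" and \<sigma>w \<sigma>b :: real and x x' :: "real ^ 'n"
    and p q \<gamma> lam e s :: "nat \<Rightarrow> real"
  assumes "tanh_like \<phi>"
    and "\<sigma>w \<ge> 0" and "\<sigma>b \<ge> 0"
    and "rrn_mean_field \<phi> \<sigma>w \<sigma>b x x' p q \<gamma> lam"
    and "\<And>l. e l = \<gamma> l / p l"
    and "\<And>l. s l = p l - \<gamma> l"
    and "x \<noteq> 0"
    and "e 0 < 1"
  shows
    "(\<sigma>w = 0 \<longrightarrow>
       (\<forall>l. \<gamma> l = real l * W \<phi> (\<sigma>b\<^sup>2) (\<sigma>b\<^sup>2) + \<gamma> 0) \<and>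
       (\<forall>l. \<gamma> l = real l * V \<phi> (\<sigma>b\<^sup>2) + \<gamma> 0) \<and>
       (\<forall>l\<ge>1. lam l = \<sigma>b\<^sup>2) \<and>
       (\<sigma>b > 0 \<longrightarrow> e \<longlonglongrightarrow> 1 \<and> (\<lambda>l. 1 - e l) \<in> \<Theta>(\<lambda>l. 1 / real l)) \<and>
       (\<forall>l. s l = p l * (1 - e l)) \<and>
       s \<in> \<Theta>(\<lambda>l. 1)) \<and>
     (\<sigma>w > 0 \<longrightarrow>
       ((\<sigma>b > 0 \<or> e 0 \<noteq> -1) \<and> lam 1 \<noteq> 0 \<longrightarrow>
          \<gamma> \<in> Theta_check (\<lambda>l. real l powr (2 / pi)) \<and>
          e \<in> Theta_check (\<lambda>l. real l powr (2 / pi - 1))) \<and>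
       (\<sigma>b > 0 \<or> e 0 \<noteq> -1 \<longrightarrow> e \<longlonglongrightarrow> 0) \<and>
       s \<in> \<Theta>(p) \<and> p \<in> \<Theta>(\<lambda>l. real l) \<and> s \<in> \<Theta>(\<lambda>l. real l))"
proof -
  interpret tanh_nonlinearity \<phi> by unfold_locales fact
  note [simp] = \<open>x \<noteq> 0\<close>
  have n: "real CARD('n) > 0" by simp
  have p0: "p 0 = (norm x)\<^sup>2 / real CARD('n)" "p 0 = (norm x')\<^sup>2 / real CARD('n)"
    "\<gamma> 0 = (x \<bullet> x') / real CARD('n)"
    using assms(4) by (auto simp: rrn_mean_field_def)
  \<comment> \<open>For x = 0 the quotient \<open>e 0\<close> would be 0 by convention and
    \<open>e 0 < 1\<close> would carry no information.\<close>
  have p_pos: "p 0 > 0" using n by (simp add: p0(1))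
  have less: "\<gamma> 0 < p 0" using \<open>e 0 < 1\<close> p_pos by (simp add: assms(5) pos_divide_less_eq)
  have "(norm x)\<^sup>2 = (norm x')\<^sup>2" using p0(1,2) n by simp
  then have "norm x = norm x'" by (simp add: power2_eq_iff_nonneg)
  \<comment> \<open>Equal norms turn Cauchy-Schwarz into |gamma 0| \<le> p 0, whose lower half is
    needed when lam is negative.\<close>
  then have "\<bar>x \<bullet> x'\<bar> \<le> (norm x)\<^sup>2" using Cauchy_Schwarz_ineq2[of x x'] by (simp add: power2_eq_square)
  then have "- ((norm x)\<^sup>2) \<le> x \<bullet> x'" by linarith
  then have "- ((norm x)\<^sup>2) / real CARD('n) \<le> (x \<bullet> x') / real CARD('n)" by (rule divide_right_mono) simp
  then have ge: "- p 0 \<le> \<gamma> 0" by (simp add: p0(1,3))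
  show ?thesis
  proof (rule conjI; rule impI)
    assume "\<sigma>w = 0"
    then have "rrn_mean_field \<phi> 0 \<sigma>b x x' p q \<gamma> lam" using assms(4) by simp
    from rrn_sw_zero[where e=e and s=s, OF this p_pos less assms(5,6)]
    show "(\<forall>l. \<gamma> l = real l * W \<phi> (\<sigma>b\<^sup>2) (\<sigma>b\<^sup>2) + \<gamma> 0) \<and>
       (\<forall>l. \<gamma> l = real l * V \<phi> (\<sigma>b\<^sup>2) + \<gamma> 0) \<and>
       (\<forall>l\<ge>1. lam l = \<sigma>b\<^sup>2) \<and>
       (\<sigma>b > 0 \<longrightarrow> e \<longlonglongrightarrow> 1 \<and> (\<lambda>l. 1 - e l) \<in> \<Theta>(\<lambda>l. 1 / real l)) \<and>
       (\<forall>l. s l = p l * (1 - e l)) \<and> s \<in> \<Theta>(\<lambda>l. 1)" .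
  next
    assume "\<sigma>w > 0"
    from rrn_sw_pos[where e=e and s=s, OF this assms(4) p_pos less ge assms(5,6)]
    show "((\<sigma>b > 0 \<or> e 0 \<noteq> -1) \<and> lam 1 \<noteq> 0 \<longrightarrow>
          \<gamma> \<in> Theta_check (\<lambda>l. real l powr (2 / pi)) \<and>
          e \<in> Theta_check (\<lambda>l. real l powr (2 / pi - 1))) \<and>
       (\<sigma>b > 0 \<or> e 0 \<noteq> -1 \<longrightarrow> e \<longlonglongrightarrow> 0) \<and>
       s \<in> \<Theta>(p) \<and> p \<in> \<Theta>(\<lambda>l. real l) \<and> s \<in> \<Theta>(\<lambda>l. real l)" .
  qed
qed

end
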